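(* Let $\mathscr{H}$ be a complex separable Hilbert space, let $n\ge 1$ be an integer, let $p,q>0$ be real numbers with $\frac1p+\frac1q=1$, and let $A_1,\ldots,A_n\in\mathbb{B}_p(\mathscr{H})$. If $1<p\le 2$, then $$\left\|\sum_{i=1}^n A_i\right\|_p^q+\sum_{1\le i<j\le n}\|A_i-A_j\|_p^q\le n\left(\sum_{i=1}^n\|A_i\|_p^p\right)^{\frac{q}{p}},$$ and if $p\ge 2$, then $$n\left(\sum_{i=1}^n\|A_i\|_p^p\right)^{\frac{q}{p}}\le\left\|\sum_{i=1}^n A_i\right\|_p^q+\sum_{1\le i<j\le n}\|A_i-A_j\|_p^q.$$
   Context: $\mathbb{B}(\mathscr{H})$ denotes the algebra of all bounded linear operators on the complex separable Hilbert space $\mathscr{H}$. For a compact $X\in\mathbb{B}(\mathscr{H})$, $\{s_j(X)\}$ is the decreasingly ordered sequence of singular values of $X$, and for $0<p<\infty$, $\|X\|_p=\left(\sum_j s_j(X)^p\right)^{1/p}=\left(\operatorname{tr}|X|^p\right)^{1/p}$, where $\operatorname{tr}$ is the usual trace and $|X|=(X^*X)^{1/2}$. The $p$-Schatten class $\mathbb{B}_p(\mathscr{H})$ is the set of (compact) $X\in\mathbb{B}(\mathscr{H})$ with $\|X\|_p<\infty$. *)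

theory Defs
  imports "HOL-Analysis.Analysis"
begin

text \<open>
  Complex inner product spaces. The class extends \<open>real_inner\<close>, whose inner product is
  required to be the real part of the complex one; thus the norm, the metric, the topology and
  the real scalar multiplication are those of the complex space. The complex inner
  product is linear in its first argument.
\<close>

class complex_inner = real_inner +
  fixes scaleC :: "complex \<Rightarrow> 'a \<Rightarrow> 'a"  (infixr \<open>*\<^sub>C\<close> 75)
    and cinner :: "'a \<Rightarrow> 'a \<Rightarrow> complex"
  assumes scaleC_add_right: "a *\<^sub>C (x + y) = a *\<^sub>C x + a *\<^sub>C y"
    and scaleC_add_left: "(a + b) *\<^sub>C x = a *\<^sub>C x + b *\<^sub>C x"
    and scaleC_scaleC: "a *\<^sub>C (b *\<^sub>C x) = (a * b) *\<^sub>C x"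
    and scaleC_one: "1 *\<^sub>C x = x"
    and scaleR_scaleC: "scaleR r x = complex_of_real r *\<^sub>C x"
    and cinner_commute: "cinner x y = cnj (cinner y x)"
    and cinner_add_left: "cinner (x + y) z = cinner x z + cinner y z"
    and cinner_scaleC_left: "cinner (a *\<^sub>C x) y = a * cinner x y"
    and inner_eq_Re_cinner: "inner x y = Re (cinner x y)"

class complex_hilbert_space = complex_inner + complete_space

interpretation complex_vector: vector_space "scaleC :: complex \<Rightarrow> 'a \<Rightarrow> 'a::complex_inner"
  by unfold_locales (simp_all add: scaleC_add_right scaleC_add_left scaleC_scaleC scaleC_one)

text \<open>
  The type \<^typ>\<open>'a \<Rightarrow>\<^sub>L 'a\<close> consists of the bounded real-linear operators; the algebra of all
  bounded linear operators on the complex space is the following subset of it.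
\<close>

definition bounded_ops :: "('a::complex_inner \<Rightarrow>\<^sub>L 'a) set" where
  "bounded_ops = {T :: 'a \<Rightarrow>\<^sub>L 'a. \<forall>c x. T (c *\<^sub>C x) = c *\<^sub>C T x}"

definition compact_op :: "('a::complex_inner \<Rightarrow>\<^sub>L 'a) \<Rightarrow> bool" where
  "compact_op T \<longleftrightarrow> compact (closure (blinfun_apply T ` cball 0 1))"

definition adjoint_op :: "('a::complex_hilbert_space \<Rightarrow>\<^sub>L 'a) \<Rightarrow> ('a \<Rightarrow>\<^sub>L 'a)" where
  "adjoint_op T = (THE S :: 'a \<Rightarrow>\<^sub>L 'a. S \<in> bounded_ops \<and> (\<forall>x y. cinner (T x) y = cinner x (S y)))"

definition positive_op :: "('a::complex_inner \<Rightarrow>\<^sub>L 'a) \<Rightarrow> bool" where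
  "positive_op T \<longleftrightarrow> T \<in> bounded_ops \<and> (\<forall>x. cinner (T x) x \<in> \<real>\<^sub>\<ge>\<^sub>0)"

text \<open>\<open>abs_op T\<close> is the positive square root of \<open>T\<^sup>* T\<close>.\<close>

definition abs_op :: "('a::complex_hilbert_space \<Rightarrow>\<^sub>L 'a) \<Rightarrow> ('a \<Rightarrow>\<^sub>L 'a)" where
  "abs_op T = (THE P. positive_op P \<and> P o\<^sub>L P = adjoint_op T o\<^sub>L T)"

definition eigenspace :: "('a::complex_inner \<Rightarrow>\<^sub>L 'a) \<Rightarrow> complex \<Rightarrow> 'a set" where
  "eigenspace T \<mu> = {x. T x = \<mu> *\<^sub>C x}"

text \<open>
  The singular values of a compact operator \<open>T\<close>, indexed from \<open>0\<close>: the decreasing sequence in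
  which every positive eigenvalue of \<open>abs_op T\<close> is listed as often as its (complex, finite)
  multiplicity. If there are only finitely many of them, the sequence continues with zeros; if
  there are infinitely many, zero does not occur in it. For operators that are not compact the
  value is meaningless.
\<close>

definition singular_values :: "('a::complex_hilbert_space \<Rightarrow>\<^sub>L 'a) \<Rightarrow> nat \<Rightarrow> real" where
  "singular_values T =
    (THE s. decseq s \<and> (\<forall>j. 0 \<le> s j) \<and>
       (\<forall>\<mu>>0. finite {j. s j = \<mu>} \<and>
          card {j. s j = \<mu>} = complex_vector.dim (eigenspace (abs_op T) (complex_of_real \<mu>))))"

definition schatten_class :: "real \<Rightarrow> ('a::complex_hilbert_space \<Rightarrow>\<^sub>L 'a) set" where
  "schatten_class p =
    {T \<in> bounded_ops. compact_op T \<and> summable (\<lambda>j. singular_values T j powr p)}"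

definition schatten_norm :: "real \<Rightarrow> ('a::complex_hilbert_space \<Rightarrow>\<^sub>L 'a) \<Rightarrow> real" where
  "schatten_norm p T = (\<Sum>j. singular_values T j powr p) powr (1 / p)"

end

theory Submission
  imports Defs "HOL-Complex_Analysis.Conformal_Mappings"
begin

text \<open>
  Write \<open>D\<^sub>k = \<Sum>\<^sub>i t\<^sub>k\<^sub>i A\<^sub>i\<close> for the sum and the differences of the operators. The coefficients satisfy
  \<open>\<bar>t\<^sub>k\<^sub>i\<bar> \<le> 1\<close> and \<open>\<Sum>\<^sub>k t\<^sub>k\<^sub>i t\<^sub>k\<^sub>j = n \<delta>\<^sub>i\<^sub>j\<close>, so that \<open>A \<mapsto> D\<close> has norm \<open>1\<close> from \<open>\<ell>\<^sub>1(S\<^sub>1)\<close> to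
  \<open>\<ell>\<^sub>\<infinity>(S\<^sub>1)\<close> and norm \<open>sqrt n\<close> from \<open>\<ell>\<^sub>2(S\<^sub>2)\<close> to \<open>\<ell>\<^sub>2(S\<^sub>2)\<close>; complex interpolation gives the norm
  \<open>n powr (1/q)\<close> from \<open>\<ell>\<^sub>p(S\<^sub>p)\<close> to \<open>\<ell>\<^sub>q(S\<^sub>p)\<close> for \<open>1 < p \<le> 2\<close>. Singular value decompositions turn the dual
  pairing into a finite bilinear form in the singular values, whose coefficients are inner products
  of singular vectors; there the interpolation only needs the three lines theorem for finite sums of
  exponentials. For \<open>p \<ge> 2\<close> the same estimate is applied to the transposed map, which inverts
  \<open>A \<mapsto> D\<close> up to the factor \<open>n\<close>.
\<close>

section \<open>Complex inner products and orthogonal systems\<close>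

text \<open>Singular values enter only through definite descriptions, so the proof has to reach them
  without a theory of traces and Schatten duality. What makes this possible is that the j-th
  singular value of an operator T equals the matrix coefficient of T at its j-th singular vectors,
  an expression linear in T once the vectors are fixed. The functional attaining the norm can
  therefore be written down explicitly in an operator's own singular vectors and truncated to
  finitely many terms; limits are taken only at the end. The interpolation parameter is \<theta> =
  2/q: it solves 1/p = (1 - \<theta>) + \<theta>/2, the condition for the domain and for the inner
  exponent of the target, and 1/q = \<theta>/2, the condition for the outer exponent. The endpoint
  constant sqrt n becomes n powr (1/q), whose q-th power is the factor n of the theorem. Membership
  of the combinations in the Schatten class must be settled before norms are compared, because the
  series in \<open>schatten_norm\<close> means nothing when it diverges.\<close>

lemma cinner_add_right: "cinner x (y + z) = cinner x y + cinner x (z::'a::complex_inner)"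
  by (metis cinner_add_left cinner_commute complex_cnj_add)

lemma cinner_scaleC_right: "cinner x (a *\<^sub>C y) = cnj a * cinner x (y::'a::complex_inner)"
  by (metis cinner_scaleC_left cinner_commute complex_cnj_mult)

lemma cinner_zero_left [simp]: "cinner 0 (x::'a::complex_inner) = 0"
  using cinner_add_left[of 0 0 x] by simp

lemma cinner_zero_right [simp]: "cinner (x::'a::complex_inner) 0 = 0"
  using cinner_add_right[of x 0 0] by simp

lemma cinner_minus_left: "cinner (- x) y = - cinner x (y::'a::complex_inner)"
  using cinner_add_left[of x "- x" y] by (simp add: eq_neg_iff_add_eq_0 add.commute)

lemma cinner_minus_right: "cinner x (- y) = - cinner x (y::'a::complex_inner)"
  using cinner_add_right[of x y "- y"] by (simp add: eq_neg_iff_add_eq_0 add.commute)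

lemma cinner_diff_left: "cinner (x - y) z = cinner x z - cinner y (z::'a::complex_inner)"
  using cinner_add_left[of x "- y" z] by (simp add: cinner_minus_left)

lemma cinner_diff_right: "cinner x (y - z) = cinner x y - cinner x (z::'a::complex_inner)"
  using cinner_add_right[of x y "- z"] by (simp add: cinner_minus_right)

lemma cinner_sum_left: "cinner (\<Sum>i\<in>S. f i) y = (\<Sum>i\<in>S. cinner (f i) (y::'a::complex_inner))"
  by (induction S rule: infinite_finite_induct) (auto simp: cinner_add_left)

lemma cinner_sum_right: "cinner y (\<Sum>i\<in>S. f i) = (\<Sum>i\<in>S. cinner (y::'a::complex_inner) (f i))"
  by (induction S rule: infinite_finite_induct) (auto simp: cinner_add_right)

lemma cinner_scaleR_left: "cinner (r *\<^sub>R x) y = of_real r * cinner x (y::'a::complex_inner)"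
  by (simp add: scaleR_scaleC cinner_scaleC_left)

lemma cinner_scaleR_right: "cinner x (r *\<^sub>R y) = of_real r * cinner x (y::'a::complex_inner)"
  by (simp add: scaleR_scaleC cinner_scaleC_right)

lemmas cinner_simps = cinner_add_left cinner_add_right cinner_diff_left cinner_diff_right
  cinner_scaleC_left cinner_scaleC_right cinner_scaleR_left cinner_scaleR_right
  cinner_minus_left cinner_minus_right

lemma cinner_self: "cinner x x = of_real ((norm (x::'a::complex_inner))\<^sup>2)"
proof -
  have "Im (cinner x x) = 0"
    using cinner_commute[of x x] by (metis cnj.simps(2) equal_neg_zero)
  then show ?thesis
    by (auto simp: complex_eq_iff power2_norm_eq_inner inner_eq_Re_cinner)
qed

lemma norm_sq_cinner: "(norm (x::'a::complex_inner))\<^sup>2 = Re (cinner x x)"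
  by (simp add: cinner_self)

lemma norm_scaleC: "norm (c *\<^sub>C (x::'a::complex_inner)) = cmod c * norm x"
proof -
  have "cinner (c *\<^sub>C x) (c *\<^sub>C x) = (c * cnj c) * cinner x x"
    by (simp add: cinner_simps)
  also have "\<dots> = of_real ((cmod c * norm x)\<^sup>2)"
    by (simp only: complex_norm_square[symmetric] cinner_self of_real_mult[symmetric] power_mult_distrib)
  finally have "(norm (c *\<^sub>C x))\<^sup>2 = (cmod c * norm x)\<^sup>2"
    by (simp only: norm_sq_cinner Re_complex_of_real)
  then show ?thesis by simp
qed

lemma norm_cinner_le: "cmod (cinner x y) \<le> norm x * norm (y::'a::complex_inner)"
proof (cases "cinner x y = 0")
  case False
  define c where "c = cnj (sgn (cinner x y))"
  have c: "cmod c = 1"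
    using False by (simp add: c_def norm_sgn)
  have "cinner (c *\<^sub>C x) y = cnj (sgn (cinner x y)) * (cmod (cinner x y) * sgn (cinner x y))"
    unfolding c_def by (simp add: cinner_simps sgn_eq False)
  also have "\<dots> = of_real (cmod (cinner x y)) * (sgn (cinner x y) * cnj (sgn (cinner x y)))"
    by (simp only: mult_ac)
  also have "\<dots> = of_real (cmod (cinner x y))"
    using False by (simp only: complex_norm_square[symmetric]) (simp add: norm_sgn)
  finally have "cinner (c *\<^sub>C x) y = of_real (cmod (cinner x y))" .
  then have "cmod (cinner x y) = inner (c *\<^sub>C x) y"
    by (simp add: inner_eq_Re_cinner)
  also have "\<dots> \<le> norm (c *\<^sub>C x) * norm y"
    by (rule norm_cauchy_schwarz)
  finally show ?thesis by (simp add: norm_scaleC c)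
qed simp

lemma bounded_bilinear_cinner: "bounded_bilinear (cinner :: 'a::complex_inner \<Rightarrow> _)"
proof
  show "\<exists>K. \<forall>x y. norm (cinner x (y::'a)) \<le> norm x * norm y * K"
    by (rule exI[of _ 1]) (simp add: norm_cinner_le)
qed (simp_all add: cinner_simps scaleR_conv_of_real)

lemma cinner_eqI:
  assumes "\<And>z. cinner x z = cinner y (z::'a::complex_inner)" shows "x = y"
proof -
  have "cinner (x - y) (x - y) = 0"
    using assms[of "x - y"] by (simp add: cinner_diff_left)
  then show ?thesis by (simp add: cinner_self)
qed

lemma norm_diff_sq:
  "(norm (x - y))\<^sup>2 = (norm x)\<^sup>2 - 2 * Re (cinner x y) + (norm (y::'a::complex_inner))\<^sup>2"
proof -
  have "Re (cinner y x) = Re (cinner x y)"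
    using cinner_commute[of x y] by simp
  then show ?thesis
    by (simp add: norm_sq_cinner cinner_simps)
qed

text \<open>
  Zero vectors are allowed, so that the singular vectors of an operator of finite rank can be
  indexed by all natural numbers.
\<close>

definition ortho_sys :: "'b set \<Rightarrow> ('b \<Rightarrow> 'a::complex_inner) \<Rightarrow> bool" where
  "ortho_sys S e \<longleftrightarrow> (\<forall>i\<in>S. norm (e i) = 0 \<or> norm (e i) = 1) \<and>
     (\<forall>i\<in>S. \<forall>j\<in>S. i \<noteq> j \<longrightarrow> cinner (e i) (e j) = 0)"

lemma ortho_sys_norm_le: "ortho_sys S e \<Longrightarrow> i \<in> S \<Longrightarrow> norm (e i) \<le> 1"
  unfolding ortho_sys_def by force

lemma ortho_sys_subset: "ortho_sys S e \<Longrightarrow> S' \<subseteq> S \<Longrightarrow> ortho_sys S' e"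
  unfolding ortho_sys_def by (simp add: subset_iff)

lemma ortho_sys_cinner:
  assumes "ortho_sys S e" "i \<in> S" "j \<in> S"
  shows "cinner (e i) (e j) = (if i = j then of_real ((norm (e i))\<^sup>2) else 0)"
  using assms unfolding ortho_sys_def by (auto simp: cinner_self)

lemma ortho_sys_norm_sum:
  assumes e: "ortho_sys S e" and S: "finite S"
  shows "(norm (\<Sum>i\<in>S. c i *\<^sub>C e i))\<^sup>2 = (\<Sum>i\<in>S. (cmod (c i))\<^sup>2 * (norm (e i))\<^sup>2)"
proof -
  have "cinner (\<Sum>i\<in>S. c i *\<^sub>C e i) (\<Sum>i\<in>S. c i *\<^sub>C e i)
      = (\<Sum>j\<in>S. \<Sum>i\<in>S. cnj (c j) * c i * cinner (e i) (e j))"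
    by (simp add: cinner_sum_left cinner_sum_right cinner_simps sum_distrib_left mult.assoc)
  also have "\<dots> = (\<Sum>j\<in>S. \<Sum>i\<in>S. if i = j then cnj (c j) * c j * of_real ((norm (e j))\<^sup>2) else 0)"
    by (intro sum.cong refl) (auto simp: ortho_sys_cinner[OF e])
  also have "\<dots> = (\<Sum>j\<in>S. of_real ((cmod (c j))\<^sup>2 * (norm (e j))\<^sup>2))"
    using S by (simp only: sum.delta if_True of_real_mult complex_norm_square)
      (simp add: mult.commute cong: sum.cong)
  finally show ?thesis
    by (simp only: norm_sq_cinner of_real_sum[symmetric] Re_complex_of_real)
qed

lemma ortho_sys_norm_sum_le:
  assumes e: "ortho_sys S e" and S: "finite S"
  shows "(norm (\<Sum>i\<in>S. c i *\<^sub>C e i))\<^sup>2 \<le> (\<Sum>i\<in>S. (cmod (c i))\<^sup>2)"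
  unfolding ortho_sys_norm_sum[OF assms]
  by (intro sum_mono mult_left_le) (auto intro!: power_le_one ortho_sys_norm_le[OF e])

lemma bessel:
  assumes e: "ortho_sys S e" and S: "finite S"
  shows "(\<Sum>i\<in>S. (cmod (cinner x (e i)))\<^sup>2) \<le> (norm x)\<^sup>2"
proof -
  define y where "y = (\<Sum>i\<in>S. cinner x (e i) *\<^sub>C e i)"
  have "cinner x y = of_real (\<Sum>i\<in>S. (cmod (cinner x (e i)))\<^sup>2)"
    by (simp add: y_def cinner_sum_right cinner_simps of_real_sum)
      (simp only: of_real_power[symmetric] complex_norm_square mult.commute)
  then have "0 \<le> (norm x)\<^sup>2 - 2 * (\<Sum>i\<in>S. (cmod (cinner x (e i)))\<^sup>2) + (norm y)\<^sup>2"
    using norm_diff_sq[of x y] by (metis Re_complex_of_real zero_le_power2)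
  then show ?thesis
    using ortho_sys_norm_sum_le[OF assms, of "\<lambda>i. cinner x (e i)"] unfolding y_def by linarith
qed

lemma bessel_left:
  assumes "ortho_sys S e" and "finite S"
  shows "(\<Sum>i\<in>S. (cmod (cinner (e i) x))\<^sup>2) \<le> (norm x)\<^sup>2"
  using bessel[OF assms, of x] by (simp add: cinner_commute[of _ x])

text \<open>The arithmetic-geometric mean inequality separates the two factors, and each half is a
  Bessel sum. This is what makes matrices of products of inner products doubly
  substochastic.\<close>

lemma bessel_product:
  assumes "ortho_sys S e" "ortho_sys S f" "finite S" "norm x \<le> 1" "norm y \<le> 1"
  shows "(\<Sum>i\<in>S. cmod (cinner x (e i)) * cmod (cinner (f i) y)) \<le> 1"
proof -
  have "(\<Sum>i\<in>S. cmod (cinner x (e i)) * cmod (cinner (f i) y))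
      \<le> (\<Sum>i\<in>S. ((cmod (cinner x (e i)))\<^sup>2 + (cmod (cinner (f i) y))\<^sup>2) / 2)"
  proof (intro sum_mono)
    fix i
    show "cmod (cinner x (e i)) * cmod (cinner (f i) y)
      \<le> ((cmod (cinner x (e i)))\<^sup>2 + (cmod (cinner (f i) y))\<^sup>2) / 2"
      using sum_squares_bound[of "cmod (cinner x (e i))" "cmod (cinner (f i) y)"] by simp
  qed
  also have "\<dots> = ((\<Sum>i\<in>S. (cmod (cinner x (e i)))\<^sup>2) + (\<Sum>i\<in>S. (cmod (cinner (f i) y))\<^sup>2)) / 2"
    by (simp add: sum.distrib sum_divide_distrib[symmetric])
  also have "\<dots> \<le> ((norm x)\<^sup>2 + (norm y)\<^sup>2) / 2"
    using bessel[OF assms(1,3), of x] bessel_left[OF assms(2,3), of y] by simp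
  also have "\<dots> \<le> 1"
    using power_le_one[of "norm x" 2] power_le_one[of "norm y" 2] assms by simp
  finally show ?thesis .
qed

text \<open>Gram-Schmidt, adding the normalized residual of one vector at a time. It supplies finite
  coordinates for Hilbert-Schmidt sums, so that no basis of the whole space is required.\<close>

lemma finite_ortho_basis:
  assumes "finite S"
  shows "\<exists>G::'a::complex_inner set. finite G \<and> ortho_sys G (\<lambda>x. x) \<and>
    (\<forall>v\<in>S. v = (\<Sum>g\<in>G. cinner v g *\<^sub>C g))"
  using assms
proof (induction S)
  case empty
  show ?case by (rule exI[of _ "{}"]) (simp add: ortho_sys_def)
next
  case (insert v S)
  then obtain G where G: "finite G" "ortho_sys G (\<lambda>x. x)"
      "\<And>v. v \<in> S \<Longrightarrow> v = (\<Sum>g\<in>G. cinner v g *\<^sub>C (g::'a))" by auto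
  define r where "r = v - (\<Sum>g\<in>G. cinner v g *\<^sub>C g)"
  show ?case
  proof (cases "r = 0")
    case True
    then show ?thesis using G r_def by (intro exI[of _ G]) auto
  next
    case False
    have rg: "cinner r h = 0" if "h \<in> G" for h
    proof -
      have "(\<Sum>g\<in>G. cinner v g * cinner g h) = (\<Sum>g\<in>G. if g = h then cinner v h else 0)"
        using that G(2) unfolding ortho_sys_def
        by (intro sum.cong refl) (auto simp: cinner_self)
      then show ?thesis
        using that G(1) by (simp add: r_def cinner_simps cinner_sum_left)
    qed
    define e where "e = (1 / norm r) *\<^sub>R r"
    have eg: "cinner e h = 0" "cinner h e = 0" if "h \<in> G" for h
      using rg[OF that] cinner_commute[of h r] by (simp_all add: e_def cinner_simps)
    have ne: "norm e = 1" using False by (simp add: e_def)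
    have "e \<notin> G" using eg(1)[of e] ne by (auto simp: cinner_self)
    have ve: "cinner v e *\<^sub>C e = r"
    proof -
      have "cinner v e = cinner r e"
        by (simp add: r_def cinner_simps cinner_sum_left eg)
      also have "\<dots> = of_real (norm r)"
        using False by (simp add: e_def cinner_simps cinner_self power2_eq_square)
      finally show ?thesis
        using False by (simp add: e_def scaleR_scaleC scaleC_scaleC scaleC_one)
    qed
    have se: "cinner x e = 0" if "x \<in> S" for x
    proof -
      have "cinner (\<Sum>g\<in>G. cinner x g *\<^sub>C g) e = 0"
        by (simp add: cinner_sum_left cinner_simps eg)
      then show ?thesis using G(3)[OF that] by simp
    qed
    have zero: "0 *\<^sub>C e = 0"
      using scaleC_add_left[of 0 0 e] by simp
    show ?thesis
    proof (intro exI[of _ "insert e G"] conjI ballI)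
      show "ortho_sys (insert e G) (\<lambda>x. x)"
        using G(2) eg ne unfolding ortho_sys_def by auto
      fix x assume "x \<in> insert v S"
      then show "x = (\<Sum>g\<in>insert e G. cinner x g *\<^sub>C g)"
      proof
        assume "x = v" then show ?thesis
          using \<open>e \<notin> G\<close> G(1) ve by (simp add: r_def)
      next
        assume "x \<in> S" then show ?thesis
          using \<open>e \<notin> G\<close> G(1) G(3)[of x] se[of x] zero by simp
      qed
    qed (use G in auto)
  qed
qed

section \<open>The Hadamard three lines theorem\<close>

text \<open>The factor exp(\<epsilon> (z^2 - 1)) has modulus at most 1 on the strip and decays as
  the imaginary part grows. The maximum principle on a tall rectangle bounds the damped function,
  and \<epsilon> then tends to 0.\<close>

lemma three_lines_normalized:
  fixes f :: "complex \<Rightarrow> complex"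
  assumes f: "f holomorphic_on UNIV"
    and bdd: "\<And>z. 0 \<le> Re z \<Longrightarrow> Re z \<le> 1 \<Longrightarrow> norm (f z) \<le> B"
    and le: "\<And>z. Re z = 0 \<or> Re z = 1 \<Longrightarrow> norm (f z) \<le> 1"
    and z: "0 \<le> Re z" "Re z \<le> 1"
  shows "norm (f z) \<le> 1"
proof -
  have key: "norm (f z) * norm (exp (of_real \<epsilon> * (z\<^sup>2 - 1))) \<le> 1" if \<epsilon>: "\<epsilon> > 0" for \<epsilon> :: real
  proof -
    define g where "g = (\<lambda>z. f z * exp (of_real \<epsilon> * (z\<^sup>2 - 1)))"
    \<comment> \<open>The rectangle must contain \<open>z\<close>, and \<epsilon> R^2 must be at
      least |B|: on the horizontal sides the damped function is then at most |B| exp(-|B|), which is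
      below 1.\<close>
    define R where "R = max (\<bar>Im z\<bar>) (sqrt (\<bar>B\<bar> / \<epsilon>)) + 1"
    have R: "R > \<bar>Im z\<bar>" "R > 0" "R\<^sup>2 \<ge> \<bar>B\<bar> / \<epsilon>"
    proof -
      have "sqrt (\<bar>B\<bar> / \<epsilon>) \<le> R" by (simp add: R_def)
      then show "R\<^sup>2 \<ge> \<bar>B\<bar> / \<epsilon>" by (rule sqrt_le_D)
    qed (auto simp: R_def)
    have gnorm: "norm (g w) = norm (f w) * exp (\<epsilon> * ((Re w)\<^sup>2 - (Im w)\<^sup>2 - 1))" for w
      by (simp add: g_def norm_mult power2_eq_square)
    let ?S = "cbox (Complex 0 (-R)) (Complex 1 R)"
    have hol: "g holomorphic_on A" for A
      unfolding g_def by (intro holomorphic_intros holomorphic_on_subset[OF f]) auto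
    have "norm (g z) \<le> 1"
    proof (rule maximum_modulus_frontier[of g ?S])
      show "continuous_on (closure ?S) g"
        using hol holomorphic_on_imp_continuous_on by blast
      fix w assume "w \<in> frontier ?S"
      then have w: "w \<in> ?S" "w \<notin> box (Complex 0 (-R)) (Complex 1 R)"
        by (auto simp: frontier_def interior_cbox)
      then have w': "0 \<le> Re w" "Re w \<le> 1" "\<bar>Im w\<bar> \<le> R"
        by (auto simp: in_cbox_complex_iff)
      have re: "(Re w)\<^sup>2 \<le> 1" using w' by (simp add: power_le_one)
      consider "Re w = 0 \<or> Re w = 1" | "\<bar>Im w\<bar> = R"
        using w w' by (fastforce simp: in_box_complex_iff)
      then show "norm (g w) \<le> 1"
      proof cases
        case 1
        have "\<epsilon> * ((Re w)\<^sup>2 - (Im w)\<^sup>2 - 1) \<le> 0"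
          using \<epsilon> re zero_le_power2[of "Im w"] by (intro mult_nonneg_nonpos) linarith+
        then show ?thesis
          unfolding gnorm using le[OF 1] by (intro mult_le_one) auto
      next
        case 2
        have "\<bar>B\<bar> \<le> \<epsilon> * R\<^sup>2"
          using R(3) \<epsilon> by (simp add: field_simps)
        also have "\<epsilon> * R\<^sup>2 \<le> - (\<epsilon> * ((Re w)\<^sup>2 - (Im w)\<^sup>2 - 1))"
        proof -
          have "(Im w)\<^sup>2 = R\<^sup>2" using 2 by (metis power2_abs)
          then have "- (\<epsilon> * ((Re w)\<^sup>2 - (Im w)\<^sup>2 - 1)) = \<epsilon> * R\<^sup>2 + \<epsilon> * (1 - (Re w)\<^sup>2)"
            by (simp add: algebra_simps)
          then show ?thesis using re \<epsilon> by simp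
        qed
        finally have B: "\<bar>B\<bar> \<le> - (\<epsilon> * ((Re w)\<^sup>2 - (Im w)\<^sup>2 - 1))" .
        have "norm (g w) \<le> \<bar>B\<bar> * exp (- \<bar>B\<bar>)"
          unfolding gnorm using bdd[of w] w' B by (intro mult_mono) auto
        also have "\<dots> \<le> 1"
          using exp_ge_add_one_self[of "\<bar>B\<bar>"] by (simp add: exp_minus field_simps del: exp_ge_add_one_self)
        finally show ?thesis .
      qed
    qed (use hol R z in \<open>auto simp: in_cbox_complex_iff\<close>)
    then show ?thesis by (simp add: g_def norm_mult)
  qed
  have "((\<lambda>\<epsilon>::real. norm (f z) * norm (exp (of_real \<epsilon> * (z\<^sup>2 - 1))))
      \<longlongrightarrow> norm (f z) * norm (exp (of_real 0 * (z\<^sup>2 - 1)))) (at_right 0)"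
    by (intro tendsto_intros)
  moreover have "\<forall>\<^sub>F \<epsilon> in at_right (0::real). norm (f z) * norm (exp (of_real \<epsilon> * (z\<^sup>2 - 1))) \<le> 1"
    using key eventually_at_right_less[of 0] by (auto elim: eventually_mono)
  ultimately have "norm (f z) * norm (exp (of_real 0 * (z\<^sup>2 - 1))) \<le> 1"
    by (rule tendsto_upperbound) simp
  then show ?thesis by simp
qed

text \<open>Dividing by \<open>M0 powr (1 - z) * M1 powr z\<close>, whose modulus is exactly
  \<open>M0\<close> and \<open>M1\<close> on the two boundary lines, reduces to the normalized
  case.\<close>

lemma three_lines:
  fixes f :: "complex \<Rightarrow> complex"
  assumes f: "f holomorphic_on UNIV"
    and bdd: "\<And>z. 0 \<le> Re z \<Longrightarrow> Re z \<le> 1 \<Longrightarrow> norm (f z) \<le> B"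
    and M: "M0 > 0" "M1 > 0"
    and le0: "\<And>z. Re z = 0 \<Longrightarrow> norm (f z) \<le> M0"
    and le1: "\<And>z. Re z = 1 \<Longrightarrow> norm (f z) \<le> M1"
    and \<theta>: "0 \<le> \<theta>" "\<theta> \<le> 1"
  shows "norm (f (of_real \<theta>)) \<le> M0 powr (1 - \<theta>) * M1 powr \<theta>"
proof -
  define h where "h = (\<lambda>z. (of_real M0 :: complex) powr (1 - z) * of_real M1 powr z)"
  have hn: "norm (h z) = M0 powr (1 - Re z) * M1 powr Re z" for z
    unfolding h_def norm_mult using M by (simp add: norm_powr_real_powr)
  have h0: "h z \<noteq> 0" for z using M by (simp add: h_def)
  \<comment> \<open>A lower bound of |h| on the strip, which keeps the quotient bounded
    there.\<close>
  define C where "C = min M0 1 * min M1 1"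
  have C: "C > 0" using M by (simp add: C_def)
  have powr_ge: "min M 1 \<le> M powr t" if "M > 0" "0 \<le> t" "t \<le> 1" for M t :: real
  proof (cases "M \<ge> 1")
    case True then show ?thesis using that by (simp add: ge_one_powr_ge_zero)
  next
    case False then show ?thesis
      using that powr_mono'[of t 1 M] by simp
  qed
  have hC: "norm (h z) \<ge> C" if "0 \<le> Re z" "Re z \<le> 1" for z
    unfolding hn C_def using that M by (intro mult_mono powr_ge) auto
  have "norm (f (of_real \<theta>) / h (of_real \<theta>)) \<le> 1"
  proof (rule three_lines_normalized[where f="\<lambda>z. f z / h z" and B="\<bar>B\<bar> / C"])
    have "h holomorphic_on UNIV"
      unfolding h_def by (intro holomorphic_intros)
    then show "(\<lambda>z. f z / h z) holomorphic_on UNIV"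
      using f h0 by (intro holomorphic_on_divide)
    show "norm (f z / h z) \<le> \<bar>B\<bar> / C" if "0 \<le> Re z" "Re z \<le> 1" for z
      unfolding norm_divide using bdd[OF that] hC[OF that] C by (intro frac_le) auto
    show "norm (f z / h z) \<le> 1" if "Re z = 0 \<or> Re z = 1" for z
      using that le0[of z] le1[of z] M by (auto simp: norm_divide hn)
  qed (use \<theta> in auto)
  then have "norm (f (of_real \<theta>)) \<le> norm (h (of_real \<theta>))"
    using h0[of "of_real \<theta>"] by (simp add: norm_divide)
  then show ?thesis by (simp add: hn)
qed


section \<open>Interpolation of a bilinear form\<close>

text \<open>
  This is \<open>\<Sum>\<^sub>k \<Sum>\<^sub>i t\<^sub>k\<^sub>i tr (A\<^sub>i Y\<^sub>k)\<close> for the operators \<open>A\<^sub>i z = \<Sum>\<^sub>a \<alpha>\<^sub>i\<^sub>a \<langle>z, u\<^sub>i\<^sub>a\<rangle> v\<^sub>i\<^sub>a\<close> and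
  \<open>Y\<^sub>k z = \<Sum>\<^sub>b \<beta>\<^sub>k\<^sub>b \<langle>z, x\<^sub>k\<^sub>b\<rangle> w\<^sub>k\<^sub>b\<close>.
\<close>

definition svform :: "'k set \<Rightarrow> 'c set \<Rightarrow> 'i set \<Rightarrow> 'b set \<Rightarrow> ('k \<Rightarrow> 'i \<Rightarrow> real) \<Rightarrow>
    ('k \<Rightarrow> 'c \<Rightarrow> 'a::complex_inner) \<Rightarrow> ('k \<Rightarrow> 'c \<Rightarrow> 'a) \<Rightarrow> ('i \<Rightarrow> 'b \<Rightarrow> 'a) \<Rightarrow> ('i \<Rightarrow> 'b \<Rightarrow> 'a) \<Rightarrow>
    ('i \<Rightarrow> 'b \<Rightarrow> complex) \<Rightarrow> ('k \<Rightarrow> 'c \<Rightarrow> complex) \<Rightarrow> complex" where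
  "svform K G I F t w x u v \<alpha> \<beta> = (\<Sum>k\<in>K. \<Sum>b\<in>G. \<Sum>i\<in>I. \<Sum>a\<in>F.
     of_real (t k i) * \<alpha> i a * \<beta> k b * (cinner (w k b) (u i a) * cinner (v i a) (x k b)))"

text \<open>The trace-class endpoint, |tr (A Y)| at most the trace norm of A times the operator norm
  of Y. With \<open>k\<close>, \<open>i\<close>, \<open>a\<close> fixed, the sum over
  \<open>b\<close> of the inner product terms is at most 1 by \<open>bessel_product\<close>.\<close>

lemma svform_l1_bound:
  assumes fin: "finite K" "finite G" "finite I" "finite F"
    and t: "\<And>k i. k \<in> K \<Longrightarrow> i \<in> I \<Longrightarrow> \<bar>t k i\<bar> \<le> 1"
    and u: "\<And>i. i \<in> I \<Longrightarrow> ortho_sys F (u i)" and v: "\<And>i. i \<in> I \<Longrightarrow> ortho_sys F (v i)"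
    and w: "\<And>k. k \<in> K \<Longrightarrow> ortho_sys G (w k)" and x: "\<And>k. k \<in> K \<Longrightarrow> ortho_sys G (x k)"
    and \<beta>: "\<And>k b. k \<in> K \<Longrightarrow> b \<in> G \<Longrightarrow> cmod (\<beta> k b) \<le> y k"
    and y: "\<And>k. k \<in> K \<Longrightarrow> 0 \<le> y k"
  shows "cmod (svform K G I F t w x u v \<alpha> \<beta>) \<le> (\<Sum>i\<in>I. \<Sum>a\<in>F. cmod (\<alpha> i a)) * (\<Sum>k\<in>K. y k)"
proof -
  let ?c = "\<lambda>k b i a. cmod (cinner (u i a) (w k b)) * cmod (cinner (x k b) (v i a))"
  have "cmod (svform K G I F t w x u v \<alpha> \<beta>) \<le> (\<Sum>k\<in>K. \<Sum>b\<in>G. \<Sum>i\<in>I. \<Sum>a\<in>F. cmod (\<alpha> i a) * y k * ?c k b i a)"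
    unfolding svform_def
  proof (intro sum_norm_le)
    fix k b i a assume *: "k \<in> K" "b \<in> G" "i \<in> I" "a \<in> F"
    have "cmod (cinner (w k b) (u i a)) = cmod (cinner (u i a) (w k b))"
      "cmod (cinner (v i a) (x k b)) = cmod (cinner (x k b) (v i a))"
      using cinner_commute[of "w k b" "u i a"] cinner_commute[of "v i a" "x k b"] by simp_all
    then have "cmod (of_real (t k i) * \<alpha> i a * \<beta> k b * (cinner (w k b) (u i a) * cinner (v i a) (x k b)))
       = (\<bar>t k i\<bar> * cmod (\<alpha> i a) * cmod (\<beta> k b)) * ?c k b i a"
      by (simp add: norm_mult)
    also have "\<dots> \<le> (1 * cmod (\<alpha> i a) * y k) * ?c k b i a"
      using * t \<beta> y by (intro mult_right_mono mult_mono) auto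
    finally show "cmod (of_real (t k i) * \<alpha> i a * \<beta> k b * (cinner (w k b) (u i a) * cinner (v i a) (x k b)))
      \<le> cmod (\<alpha> i a) * y k * ?c k b i a" by simp
  qed
  also have "\<dots> = (\<Sum>k\<in>K. \<Sum>i\<in>I. \<Sum>a\<in>F. cmod (\<alpha> i a) * y k * (\<Sum>b\<in>G. ?c k b i a))"
    by (simp only: sum_distrib_left) (simp only: sum.swap[of _ _ G])
  also have "\<dots> \<le> (\<Sum>k\<in>K. \<Sum>i\<in>I. \<Sum>a\<in>F. cmod (\<alpha> i a) * y k * 1)"
    using fin y by (intro sum_mono mult_left_mono bessel_product w x ortho_sys_norm_le[OF u] ortho_sys_norm_le[OF v]) auto
  also have "\<dots> = (\<Sum>i\<in>I. \<Sum>a\<in>F. cmod (\<alpha> i a)) * (\<Sum>k\<in>K. y k)"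
    by (simp add: sum_distrib_left sum_distrib_right)
  finally show ?thesis .
qed

text \<open>Expanding the squares leaves only inner products of columns of \<open>t\<close>, which
  are orthogonal with common square length \<open>N\<close>.\<close>

lemma sum_norm_sq_isometry:
  fixes z :: "'i \<Rightarrow> 'a::complex_inner"
  assumes fin: "finite I"
    and T: "\<And>i j. i \<in> I \<Longrightarrow> j \<in> I \<Longrightarrow> (\<Sum>k\<in>K. t k i * t k j) = (if i = j then N else 0)"
  shows "(\<Sum>k\<in>K. (norm (\<Sum>i\<in>I. t k i *\<^sub>R z i))\<^sup>2) = N * (\<Sum>i\<in>I. (norm (z i))\<^sup>2)"
proof -
  have "(\<Sum>k\<in>K. (norm (\<Sum>i\<in>I. t k i *\<^sub>R z i))\<^sup>2)
      = (\<Sum>k\<in>K. \<Sum>i\<in>I. \<Sum>j\<in>I. t k i * t k j * inner (z i) (z j))"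
    by (simp add: power2_norm_eq_inner inner_sum_left inner_sum_right sum_distrib_left mult_ac inner_commute)
  also have "\<dots> = (\<Sum>i\<in>I. \<Sum>j\<in>I. (\<Sum>k\<in>K. t k i * t k j) * inner (z i) (z j))"
    by (simp only: sum_distrib_right) (simp only: sum.swap[of _ _ K])
  also have "\<dots> = (\<Sum>i\<in>I. \<Sum>j\<in>I. if i = j then N * inner (z i) (z i) else 0)"
    by (intro sum.cong refl) (auto simp: T)
  also have "\<dots> = N * (\<Sum>i\<in>I. (norm (z i))\<^sup>2)"
    using fin by (simp add: power2_norm_eq_inner sum_distrib_left)
  finally show ?thesis .
qed

text \<open>The Hilbert-Schmidt endpoint: the form is a trace, hence a sum of inner products to
  which Cauchy-Schwarz applies, and \<open>t\<close> acts as sqrt N times an isometry.\<close>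

lemma svform_l2_bound:
  assumes fin: "finite K" "finite G" "finite I" "finite F"
    and T: "\<And>i j. i \<in> I \<Longrightarrow> j \<in> I \<Longrightarrow> (\<Sum>k\<in>K. t k i * t k j) = (if i = j then N else 0)"
    and N: "N \<ge> 0"
    and u: "\<And>i. i \<in> I \<Longrightarrow> ortho_sys F (u i)" and v: "\<And>i. i \<in> I \<Longrightarrow> ortho_sys F (v i)"
    and w: "\<And>k. k \<in> K \<Longrightarrow> ortho_sys G (w k)" and x: "\<And>k. k \<in> K \<Longrightarrow> ortho_sys G (x k)"
  shows "cmod (svform K G I F t w x u v \<alpha> \<beta>)
    \<le> sqrt (N * (\<Sum>i\<in>I. \<Sum>a\<in>F. (cmod (\<alpha> i a))\<^sup>2)) * sqrt (\<Sum>k\<in>K. \<Sum>b\<in>G. (cmod (\<beta> k b))\<^sup>2)"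
proof -
  have "finite ((\<lambda>(k,b). w k b) ` (K \<times> G))" using fin by simp
  from finite_ortho_basis[OF this] obtain B where B: "finite B" "ortho_sys B (\<lambda>x. x)"
    and wB: "\<And>k b. k \<in> K \<Longrightarrow> b \<in> G \<Longrightarrow> w k b = (\<Sum>g\<in>B. cinner (w k b) g *\<^sub>C g)"
    by fastforce
  \<comment> \<open>In operator terms, \<open>Z g i\<close> is A_i applied to \<open>g\<close>,
    \<open>A g k\<close> is the k-th combination applied to \<open>g\<close>, and
    \<open>Y g k\<close> is the adjoint of Y_k applied to \<open>g\<close>. Vectors \<open>g\<close>
    in \<open>B\<close> suffice for the trace, because the range of every Y_k lies in the span of
    \<open>B\<close>.\<close>
  define Z where "Z = (\<lambda>g i. \<Sum>a\<in>F. (\<alpha> i a * cinner g (u i a)) *\<^sub>C v i a)"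
  define Y where "Y = (\<lambda>g k. \<Sum>b\<in>G. cnj (\<beta> k b * cinner (w k b) g) *\<^sub>C x k b)"
  define A where "A = (\<lambda>g k. \<Sum>i\<in>I. t k i *\<^sub>R Z g i)"
  have AY: "svform K G I F t w x u v \<alpha> \<beta> = (\<Sum>k\<in>K. \<Sum>g\<in>B. cinner (A g k) (Y g k))"
  proof -
    have A: "cinner (A g k) (x k b) = (\<Sum>i\<in>I. \<Sum>a\<in>F. of_real (t k i) * \<alpha> i a *
        (cinner g (u i a) * cinner (v i a) (x k b)))" for g k b
      by (simp add: A_def Z_def cinner_sum_left cinner_simps sum_distrib_left mult.assoc)
    have "(\<Sum>i\<in>I. \<Sum>a\<in>F. of_real (t k i) * \<alpha> i a * \<beta> k b * (cinner (w k b) (u i a) * cinner (v i a) (x k b)))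
      = (\<Sum>g\<in>B. \<beta> k b * cinner (w k b) g * cinner (A g k) (x k b))"
      if kb: "k \<in> K" "b \<in> G" for k b
    proof -
      have "cinner (w k b) (u i a) = (\<Sum>g\<in>B. cinner (w k b) g * cinner g (u i a))" for i a
        by (subst wB[OF kb]) (simp add: cinner_sum_left cinner_simps)
      then have "(\<Sum>i\<in>I. \<Sum>a\<in>F. of_real (t k i) * \<alpha> i a * \<beta> k b * (cinner (w k b) (u i a) * cinner (v i a) (x k b)))
        = (\<Sum>i\<in>I. \<Sum>a\<in>F. \<Sum>g\<in>B. \<beta> k b * cinner (w k b) g *
            (of_real (t k i) * \<alpha> i a * (cinner g (u i a) * cinner (v i a) (x k b))))"
        by (simp add: sum_distrib_left sum_distrib_right mult_ac)
      also have "\<dots> = (\<Sum>g\<in>B. \<beta> k b * cinner (w k b) g * cinner (A g k) (x k b))"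
        unfolding A sum_distrib_left by (simp only: sum.swap[of _ _ B])
      finally show ?thesis .
    qed
    then have "svform K G I F t w x u v \<alpha> \<beta>
        = (\<Sum>k\<in>K. \<Sum>b\<in>G. \<Sum>g\<in>B. \<beta> k b * cinner (w k b) g * cinner (A g k) (x k b))"
      unfolding svform_def by (intro sum.cong refl)
    also have "\<dots> = (\<Sum>k\<in>K. \<Sum>g\<in>B. cinner (A g k) (Y g k))"
      by (simp add: Y_def cinner_sum_right cinner_simps sum.swap[of _ B G])
    finally show ?thesis .
  qed
  \<comment> \<open>After the exchange the isometry acts on the vectors \<open>Z g i\<close> for
    each fixed \<open>g\<close>; summing over \<open>g\<close> then produces Hilbert-Schmidt
    norms.\<close>
  have "(\<Sum>k\<in>K. \<Sum>g\<in>B. (norm (A g k))\<^sup>2) = (\<Sum>g\<in>B. \<Sum>k\<in>K. (norm (A g k))\<^sup>2)"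
    by (rule sum.swap)
  also have "\<dots> = (\<Sum>g\<in>B. N * (\<Sum>i\<in>I. (norm (Z g i))\<^sup>2))"
    unfolding A_def by (intro sum.cong refl sum_norm_sq_isometry fin T)
  also have "\<dots> = N * (\<Sum>i\<in>I. \<Sum>g\<in>B. (norm (Z g i))\<^sup>2)"
    by (simp add: sum_distrib_left sum.swap[of _ I B])
  also have "\<dots> \<le> N * (\<Sum>i\<in>I. \<Sum>a\<in>F. (cmod (\<alpha> i a))\<^sup>2)"
  proof (intro mult_left_mono[OF _ N] sum_mono)
    fix i assume i: "i \<in> I"
    have "(\<Sum>g\<in>B. (norm (Z g i))\<^sup>2) \<le> (\<Sum>g\<in>B. \<Sum>a\<in>F. (cmod (\<alpha> i a * cinner g (u i a)))\<^sup>2)"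
      unfolding Z_def by (intro sum_mono ortho_sys_norm_sum_le v i fin)
    also have "\<dots> = (\<Sum>a\<in>F. (cmod (\<alpha> i a))\<^sup>2 * (\<Sum>g\<in>B. (cmod (cinner g (u i a)))\<^sup>2))"
      by (simp add: norm_mult power_mult_distrib sum_distrib_left sum.swap[of _ F B])
    also have "\<dots> \<le> (\<Sum>a\<in>F. (cmod (\<alpha> i a))\<^sup>2 * 1)"
    proof (intro sum_mono mult_left_mono)
      fix a assume "a \<in> F"
      then have "(norm (u i a))\<^sup>2 \<le> 1"
        using ortho_sys_norm_le[OF u[OF i]] by (simp add: power_le_one)
      then show "(\<Sum>g\<in>B. (cmod (cinner g (u i a)))\<^sup>2) \<le> 1"
        using bessel_left[OF B(2,1), of "u i a"] by linarith
    qed auto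
    finally show "(\<Sum>g\<in>B. (norm (Z g i))\<^sup>2) \<le> (\<Sum>a\<in>F. (cmod (\<alpha> i a))\<^sup>2)" by simp
  qed
  finally have A2: "(\<Sum>k\<in>K. \<Sum>g\<in>B. (norm (A g k))\<^sup>2) \<le> N * (\<Sum>i\<in>I. \<Sum>a\<in>F. (cmod (\<alpha> i a))\<^sup>2)" .
  have Y2: "(\<Sum>k\<in>K. \<Sum>g\<in>B. (norm (Y g k))\<^sup>2) \<le> (\<Sum>k\<in>K. \<Sum>b\<in>G. (cmod (\<beta> k b))\<^sup>2)"
  proof (intro sum_mono)
    fix k assume k: "k \<in> K"
    have "(\<Sum>g\<in>B. (norm (Y g k))\<^sup>2) \<le> (\<Sum>g\<in>B. \<Sum>b\<in>G. (cmod (cnj (\<beta> k b * cinner (w k b) g)))\<^sup>2)"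
      unfolding Y_def by (intro sum_mono ortho_sys_norm_sum_le x k fin)
    also have "\<dots> = (\<Sum>b\<in>G. (cmod (\<beta> k b))\<^sup>2 * (\<Sum>g\<in>B. (cmod (cinner (w k b) g))\<^sup>2))"
      by (simp add: norm_mult power_mult_distrib sum_distrib_left sum.swap[of _ G B])
    also have "\<dots> \<le> (\<Sum>b\<in>G. (cmod (\<beta> k b))\<^sup>2 * 1)"
    proof (intro sum_mono mult_left_mono)
      fix b assume "b \<in> G"
      then have "(norm (w k b))\<^sup>2 \<le> 1"
        using ortho_sys_norm_le[OF w[OF k]] by (simp add: power_le_one)
      then show "(\<Sum>g\<in>B. (cmod (cinner (w k b) g))\<^sup>2) \<le> 1"
        using bessel[OF B(2,1), of "w k b"] by linarith
    qed auto
    finally show "(\<Sum>g\<in>B. (norm (Y g k))\<^sup>2) \<le> (\<Sum>b\<in>G. (cmod (\<beta> k b))\<^sup>2)" by simp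
  qed
  have "cmod (svform K G I F t w x u v \<alpha> \<beta>) \<le> (\<Sum>k\<in>K. \<Sum>g\<in>B. norm (A g k) * norm (Y g k))"
    unfolding AY by (intro sum_norm_le norm_cinner_le)
  also have "\<dots> = (\<Sum>(k,g)\<in>K\<times>B. norm (A g k) * norm (Y g k))"
    by (simp add: sum.cartesian_product)
  also have "\<dots> \<le> sqrt (\<Sum>(k,g)\<in>K\<times>B. (norm (A g k))\<^sup>2) * sqrt (\<Sum>(k,g)\<in>K\<times>B. (norm (Y g k))\<^sup>2)"
    using L2_set_mult_ineq[of "\<lambda>(k,g). norm (A g k)" "\<lambda>(k,g). norm (Y g k)" "K\<times>B"]
    by (simp add: L2_set_def case_prod_beta)
  also have "\<dots> \<le> sqrt (N * (\<Sum>i\<in>I. \<Sum>a\<in>F. (cmod (\<alpha> i a))\<^sup>2)) * sqrt (\<Sum>k\<in>K. \<Sum>b\<in>G. (cmod (\<beta> k b))\<^sup>2)"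
    using A2 Y2 N by (intro mult_mono) (simp_all add: sum.cartesian_product sum_nonneg case_prod_beta)
  finally show ?thesis .
qed

text \<open>Adding 1 to the base makes the power monotone in the exponent, so one bound serves the
  whole strip whether \<open>x\<close> is below or above 1.\<close>

lemma powr_le_one_plus_powr:
  fixes x \<tau> C :: real
  assumes "0 \<le> x" "0 \<le> \<tau>" "\<tau> \<le> C"
  shows "x powr \<tau> \<le> (1 + x) powr C"
proof -
  have "x powr \<tau> \<le> (1 + x) powr \<tau>" using assms by (intro powr_mono2) auto
  also have "\<dots> \<le> (1 + x) powr C" using assms by (intro powr_mono) auto
  finally show ?thesis .
qed

text \<open>The Riesz-Thorin argument: the singular values become analytic functions of z that
  return the given ones at z = \<theta>, while the singular vectors stay fixed, so both endpoint
  bounds apply to the deformed forms.\<close>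

theorem svform_interpolation:
  fixes \<alpha> :: "'i \<Rightarrow> 'b \<Rightarrow> real" and \<beta> :: "'k \<Rightarrow> 'c \<Rightarrow> real"
  assumes fin: "finite K" "finite G" "finite I" "finite F"
    and t: "\<And>k i. k \<in> K \<Longrightarrow> i \<in> I \<Longrightarrow> \<bar>t k i\<bar> \<le> 1"
    and T: "\<And>i j. i \<in> I \<Longrightarrow> j \<in> I \<Longrightarrow> (\<Sum>k\<in>K. t k i * t k j) = (if i = j then N else 0)"
    and N: "N > 0"
    and u: "\<And>i. i \<in> I \<Longrightarrow> ortho_sys F (u i)" and v: "\<And>i. i \<in> I \<Longrightarrow> ortho_sys F (v i)"
    and w: "\<And>k. k \<in> K \<Longrightarrow> ortho_sys G (w k)" and x: "\<And>k. k \<in> K \<Longrightarrow> ortho_sys G (x k)"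
    and r: "1 < r" "r \<le> 2" and rs: "1 / r + 1 / s = 1"
    and \<alpha>: "\<And>i a. i \<in> I \<Longrightarrow> a \<in> F \<Longrightarrow> 0 \<le> \<alpha> i a"
    and \<beta>: "\<And>k b. k \<in> K \<Longrightarrow> b \<in> G \<Longrightarrow> 0 \<le> \<beta> k b"
  shows "cmod (svform K G I F t w x u v (\<lambda>i a. of_real (\<alpha> i a)) (\<lambda>k b. of_real (\<beta> k b)))
    \<le> N powr (1 / s) * (\<Sum>i\<in>I. \<Sum>a\<in>F. \<alpha> i a powr r) powr (1 / r) *
      (\<Sum>k\<in>K. (\<Sum>b\<in>G. \<beta> k b powr s) powr (r / s)) powr (1 / r)"
proof -
  have s: "s \<ge> 2"
  proof -
    have "1 / s = 1 - 1 / r" using rs by simp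
    moreover have "1 / r \<ge> 1 / 2" "1 / r < 1" using r by (auto simp: field_simps)
    ultimately have "1 / s \<le> 1 / 2" "1 / s > 0" by linarith+
    then show ?thesis by (simp add: field_simps split: if_splits)
  qed
  define P where "P = (\<Sum>i\<in>I. \<Sum>a\<in>F. \<alpha> i a powr r)"
  define y where "y = (\<lambda>k. (\<Sum>b\<in>G. \<beta> k b powr s) powr (1 / s))"
  define Q where "Q = (\<Sum>k\<in>K. y k powr r)"
  have y0: "0 \<le> y k" for k by (simp add: y_def)
  have yr: "y k powr r = (\<Sum>b\<in>G. \<beta> k b powr s) powr (r / s)" for k
    by (simp add: y_def powr_powr)
  have ys: "y k powr s = (\<Sum>b\<in>G. \<beta> k b powr s)" for k
    using s by (simp add: y_def powr_powr sum_nonneg)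
  have \<beta>0: "\<beta> k b = 0" if "y k = 0" "k \<in> K" "b \<in> G" for k b
  proof -
    have "(\<Sum>b\<in>G. \<beta> k b powr s) = 0" using ys[of k] that by simp
    then have "\<beta> k b powr s = 0"
      using that fin by (subst (asm) sum_nonneg_eq_0_iff) auto
    then show ?thesis by simp
  qed
  \<comment> \<open>Forced by the outer exponent of the dual side: 1/s = \<theta>/2, equivalently
    1/r = 1 - \<theta>/2.\<close>
  define \<theta> where "\<theta> = 2 / s"
  have \<theta>: "0 \<le> \<theta>" "\<theta> \<le> 1" "1 - \<theta> / 2 = 1 / r"
    using s rs by (auto simp: \<theta>_def field_simps)
  define \<alpha>' where "\<alpha>' = (\<lambda>z i a. (of_real (\<alpha> i a) :: complex) powr (of_real r * (1 - z / 2)))"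
  \<comment> \<open>The two factors separate the mixed norm: \<open>y k\<close> is the inner s-norm
    of the k-th row and \<open>\<beta> k b / y k\<close> the normalized entry. On Re z = 0 the
    modulus is at most \<open>y k powr r\<close>; on Re z = 1 its squares sum over \<open>b\<close>
    to at most \<open>y k powr r\<close>. A row with \<open>y k = 0\<close> vanishes, and then the
    convention for division by 0 gives the value 0.\<close>
  define \<beta>' where "\<beta>' = (\<lambda>z k b. (of_real (y k) :: complex) powr (of_real r * (1 - z / 2)) *
     of_real (\<beta> k b / y k) powr (of_real s * z / 2))"
  define f where "f = (\<lambda>z. svform K G I F t w x u v (\<alpha>' z) (\<beta>' z))"
  have n\<alpha>: "cmod (\<alpha>' z i a) = \<alpha> i a powr (r * (1 - Re z / 2))" if "i \<in> I" "a \<in> F" for z i a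
    using \<alpha>[OF that] by (simp add: \<alpha>'_def norm_powr_real_powr)
  have n\<beta>: "cmod (\<beta>' z k b) = y k powr (r * (1 - Re z / 2)) * (\<beta> k b / y k) powr (s * Re z / 2)"
    if "k \<in> K" "b \<in> G" for z k b
    using \<beta>[OF that] y0[of k] unfolding \<beta>'_def norm_mult
    by (subst (1 2) norm_powr_real_powr) auto
  have f\<theta>: "f (of_real \<theta>) = svform K G I F t w x u v (\<lambda>i a. of_real (\<alpha> i a)) (\<lambda>k b. of_real (\<beta> k b))"
  proof -
    have e: "(of_real r * (1 - of_real \<theta> / 2) :: complex) = 1" "(of_real s * of_real \<theta> / 2 :: complex) = 1"
    proof -
      have "of_real (r * (1 - \<theta> / 2)) = (1::complex)" using r by (subst \<theta>(3)) simp
      then show "(of_real r * (1 - of_real \<theta> / 2) :: complex) = 1" by simp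
      have "of_real (s * \<theta> / 2) = (1::complex)" using s by (simp add: \<theta>_def)
      then show "(of_real s * of_real \<theta> / 2 :: complex) = 1" by simp
    qed
    have p1: "z powr (1::complex) = z" for z :: complex by (simp add: powr_def)
    have "\<beta>' (of_real \<theta>) k b = of_real (\<beta> k b)" if "k \<in> K" "b \<in> G" for k b
      unfolding \<beta>'_def e p1 using \<beta>0[OF _ that] by auto
    then show ?thesis unfolding f_def svform_def \<alpha>'_def e p1
      by (intro sum.cong refl) auto
  qed
  show ?thesis
  \<comment> \<open>The three lines theorem needs positive boundary constants. If one of them
    degenerates, all singular values on that side are 0 and the form vanishes.\<close>
  proof (cases "P = 0 \<or> Q = 0")
    case True
    have "(\<forall>i\<in>I. \<forall>a\<in>F. \<alpha> i a = 0) \<or> (\<forall>k\<in>K. \<forall>b\<in>G. \<beta> k b = 0)"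
    proof (cases "P = 0")
      case True
      then have "\<forall>i\<in>I. (\<Sum>a\<in>F. \<alpha> i a powr r) = 0"
        unfolding P_def using fin by (subst (asm) sum_nonneg_eq_0_iff) (auto intro: sum_nonneg)
      then have "\<forall>i\<in>I. \<forall>a\<in>F. \<alpha> i a powr r = 0"
        using fin by (subst (asm) sum_nonneg_eq_0_iff) auto
      then show ?thesis by simp
    next
      case False
      then have "Q = 0" using True by simp
      then have "\<forall>k\<in>K. y k powr r = 0"
        unfolding Q_def using fin by (subst (asm) sum_nonneg_eq_0_iff) auto
      then show ?thesis using \<beta>0 by auto
    qed
    then have "svform K G I F t w x u v (\<lambda>i a. of_real (\<alpha> i a)) (\<lambda>k b. of_real (\<beta> k b)) = 0"
      unfolding svform_def by (auto intro!: sum.neutral)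
    then show ?thesis by simp
  next
    case False
    have PQ: "P > 0" "Q > 0"
      using False sum_nonneg[of K "\<lambda>k. y k powr r"] sum_nonneg[of I "\<lambda>i. \<Sum>a\<in>F. \<alpha> i a powr r"]
      by (auto simp: P_def Q_def sum_nonneg less_le)
    \<comment> \<open>The triangle inequality applied term by term; the exponents stay in [0, r] and
      [0, s] throughout the strip.\<close>
    define B where "B = (\<Sum>k\<in>K. \<Sum>b\<in>G. \<Sum>i\<in>I. \<Sum>a\<in>F. \<bar>t k i\<bar> * (1 + \<alpha> i a) powr r *
       ((1 + y k) powr r * (1 + \<beta> k b / y k) powr s) *
       cmod (cinner (w k b) (u i a) * cinner (v i a) (x k b)))"
    have "cmod (f (of_real \<theta>)) \<le> (P * Q) powr (1 - \<theta>) * sqrt (N * P * Q) powr \<theta>"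
    proof (rule three_lines[where B=B])
      show "f holomorphic_on UNIV"
        unfolding f_def svform_def \<alpha>'_def \<beta>'_def by (intro holomorphic_intros) auto
      show "cmod (f z) \<le> B" if z: "0 \<le> Re z" "Re z \<le> 1" for z
        unfolding f_def svform_def B_def
      proof (intro sum_norm_le)
        fix k b i a assume *: "k \<in> K" "b \<in> G" "i \<in> I" "a \<in> F"
        have e: "0 \<le> r * (1 - Re z / 2)" "r * (1 - Re z / 2) \<le> r" "0 \<le> s * Re z / 2" "s * Re z / 2 \<le> s"
        proof -
          show "r * (1 - Re z / 2) \<le> r" using r z by (simp add: mult_le_cancel_left2)
          have "s * Re z \<le> s * 1" using s z by (intro mult_left_mono) auto
          then show "s * Re z / 2 \<le> s" using s by simp
        qed (use r s z in auto)
        have "cmod (\<alpha>' z i a) \<le> (1 + \<alpha> i a) powr r"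
          using * e unfolding n\<alpha>[OF *(3,4)] by (intro powr_le_one_plus_powr \<alpha>)
        moreover have "cmod (\<beta>' z k b) \<le> (1 + y k) powr r * (1 + \<beta> k b / y k) powr s"
          using * e y0[of k] \<beta>[of k b] unfolding n\<beta>[OF *(1,2)]
          by (intro mult_mono powr_le_one_plus_powr) auto
        ultimately show "cmod (of_real (t k i) * \<alpha>' z i a * \<beta>' z k b * (cinner (w k b) (u i a) * cinner (v i a) (x k b)))
          \<le> \<bar>t k i\<bar> * (1 + \<alpha> i a) powr r * ((1 + y k) powr r * (1 + \<beta> k b / y k) powr s) *
           cmod (cinner (w k b) (u i a) * cinner (v i a) (x k b))"
          unfolding norm_mult by (intro mult_mono) (auto intro!: mult_nonneg_nonneg)
      qed
      show "cmod (f z) \<le> P * Q" if z: "Re z = 0" for z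
      proof -
        have "cmod (f z) \<le> (\<Sum>i\<in>I. \<Sum>a\<in>F. cmod (\<alpha>' z i a)) * (\<Sum>k\<in>K. y k powr r)"
          unfolding f_def
        proof (rule svform_l1_bound[OF fin t u v w x])
          show "cmod (\<beta>' z k b) \<le> y k powr r" if "k \<in> K" "b \<in> G" for k b
            unfolding n\<beta>[OF that] by (simp add: z)
        qed auto
        also have "(\<Sum>i\<in>I. \<Sum>a\<in>F. cmod (\<alpha>' z i a)) = P"
          unfolding P_def by (intro sum.cong refl) (simp add: n\<alpha> z)
        finally show ?thesis by (simp add: Q_def)
      qed
      show "cmod (f z) \<le> sqrt (N * P * Q)" if z: "Re z = 1" for z
      proof -
        have sq: "(a powr (c / 2))\<^sup>2 = a powr c" for a c :: real
          by (simp add: power2_eq_square powr_add[symmetric])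
        have "cmod (f z) \<le> sqrt (N * (\<Sum>i\<in>I. \<Sum>a\<in>F. (cmod (\<alpha>' z i a))\<^sup>2)) * sqrt (\<Sum>k\<in>K. \<Sum>b\<in>G. (cmod (\<beta>' z k b))\<^sup>2)"
          unfolding f_def using N by (intro svform_l2_bound fin T u v w x) auto
        also have "(\<Sum>i\<in>I. \<Sum>a\<in>F. (cmod (\<alpha>' z i a))\<^sup>2) = P"
          unfolding P_def by (intro sum.cong refl) (simp add: n\<alpha> z sq)
        also have "sqrt (\<Sum>k\<in>K. \<Sum>b\<in>G. (cmod (\<beta>' z k b))\<^sup>2) \<le> sqrt Q"
          unfolding Q_def
        proof (intro real_sqrt_le_mono sum_mono)
          fix k assume k: "k \<in> K"
          have "(\<Sum>b\<in>G. (cmod (\<beta>' z k b))\<^sup>2) = (\<Sum>b\<in>G. y k powr r * (\<beta> k b / y k) powr s)"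
            by (intro sum.cong refl) (simp add: n\<beta> k z power_mult_distrib sq)
          also have "\<dots> = y k powr r * ((\<Sum>b\<in>G. \<beta> k b powr s) / y k powr s)"
            unfolding sum_distrib_left sum_divide_distrib
            by (intro sum.cong refl) (simp add: powr_divide \<beta> k y0)
          \<comment> \<open>By \<open>ys\<close> the quotient is 1, or 0/0 = 0 for a zero
            row.\<close>
          also have "\<dots> \<le> y k powr r * 1"
            unfolding ys by (intro mult_left_mono) auto
          finally show "(\<Sum>b\<in>G. (cmod (\<beta>' z k b))\<^sup>2) \<le> y k powr r" by simp
        qed
        finally show ?thesis
          using N PQ by (simp add: real_sqrt_mult)
      qed
    qed (use PQ N \<theta> in auto)
    also have "sqrt (N * P * Q) powr \<theta> = N powr (\<theta> / 2) * (P * Q) powr (\<theta> / 2)"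
      using PQ N by (simp add: powr_half_sqrt[symmetric] powr_powr powr_mult)
    also have "(P * Q) powr (1 - \<theta>) * (N powr (\<theta> / 2) * (P * Q) powr (\<theta> / 2))
        = N powr (\<theta> / 2) * (P * Q) powr ((1 - \<theta>) + \<theta> / 2)"
      by (simp only: powr_add mult_ac)
    also have "(1 - \<theta>) + \<theta> / 2 = 1 / r" using \<theta> by simp
    also have "\<theta> / 2 = 1 / s" by (simp add: \<theta>_def)
    finally show ?thesis
      unfolding f\<theta> using PQ by (simp add: powr_mult P_def Q_def yr mult.assoc)
  qed
qed

section \<open>Singular value decomposition of compact operators\<close>

instance complex_hilbert_space \<subseteq> banach ..

lemma scaleC_zero_left [simp]: "0 *\<^sub>C (x::'a::complex_inner) = 0"
  using scaleC_add_left[of 0 0 x] by simp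

lemma scaleC_zero_right [simp]: "c *\<^sub>C (0::'a::complex_inner) = 0"
  using scaleC_add_right[of c 0 0] by simp

lemma bounded_ops_scaleC: "T \<in> bounded_ops \<Longrightarrow> blinfun_apply T (c *\<^sub>C x) = c *\<^sub>C T x"
  by (simp add: bounded_ops_def)

lemma bounded_linear_scaleC_left: "bounded_linear (\<lambda>c. c *\<^sub>C (x::'a::complex_inner))"
proof (rule bounded_linear_intro[where K="norm x"])
  show "(r *\<^sub>R c) *\<^sub>C x = r *\<^sub>R (c *\<^sub>C x)" for r c
    by (simp add: scaleR_scaleC scaleC_scaleC scaleR_conv_of_real)
qed (simp_all add: scaleC_add_left norm_scaleC)

lemmas bounded_linear_cinner_left = bounded_bilinear.bounded_linear_left[OF bounded_bilinear_cinner]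
lemmas bounded_linear_cinner_right = bounded_bilinear.bounded_linear_right[OF bounded_bilinear_cinner]

lemma compact_op_subseq:
  assumes "compact_op T" and "\<And>n. norm (x n) \<le> 1"
  obtains l \<phi> where "strict_mono (\<phi> :: nat \<Rightarrow> nat)" "(\<lambda>n. blinfun_apply T (x (\<phi> n))) \<longlonglongrightarrow> l"
proof -
  have "seq_compact (closure (blinfun_apply T ` cball 0 1))"
    using assms(1) unfolding compact_op_def by (simp add: compact_eq_seq_compact_metric)
  moreover have "\<forall>n. T (x n) \<in> closure (blinfun_apply T ` cball 0 1)"
    using assms(2) by (intro allI subsetD[OF closure_subset]) auto
  ultimately obtain l \<phi> where "strict_mono \<phi>" "((\<lambda>n. T (x n)) \<circ> \<phi>) \<longlonglongrightarrow> l"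
    unfolding seq_compact_def by meson
  then show thesis using that by (auto simp: o_def)
qed

lemma parallelogram_law:
  "(norm (x - y))\<^sup>2 = 2 * (norm x)\<^sup>2 + 2 * (norm y)\<^sup>2 - (norm (x + y))\<^sup>2"
  for x y :: "'a::real_inner"
  by (simp add: power2_norm_eq_inner inner_simps inner_commute)

text \<open>
  No weak compactness is needed: if \<open>T y\<^sub>n\<close> converges along a maximizing sequence of unit vectors,
  then \<open>\<parallel>y\<^sub>m + y\<^sub>n\<parallel>\<close> tends to \<open>2\<close>, and the parallelogram law makes \<open>y\<^sub>n\<close> itself a Cauchy sequence.
\<close>

lemma compact_op_maximizer:
  fixes T :: "'a::complex_hilbert_space \<Rightarrow>\<^sub>L 'a"
  assumes T: "compact_op T" and M: "subspace M" "closed M" and ne: "\<exists>x\<in>M. T x \<noteq> 0"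
  shows "\<exists>e\<in>M. norm e = 1 \<and> T e \<noteq> 0 \<and> (\<forall>x\<in>M. norm (T x) \<le> norm (T e) * norm x)"
proof -
  define S where "S = (\<lambda>x. norm (T x)) ` {x\<in>M. norm x = 1}"
  have unit: "(1 / norm x) *\<^sub>R x \<in> {x\<in>M. norm x = 1}" if "x \<in> M" "x \<noteq> 0" for x
    using that M(1) by (auto intro: subspace_scale)
  obtain x0 where x0: "x0 \<in> M" "T x0 \<noteq> 0" using ne by blast
  then have x0': "x0 \<noteq> 0" using blinfun.zero_right by metis
  have bdd: "bdd_above S"
    unfolding S_def by (intro bdd_aboveI2[where M="norm T"]) (metis (mono_tags) mem_Collect_eq mult.right_neutral norm_blinfun)
  have Sne: "S \<noteq> {}" using unit[OF x0(1) x0'] by (auto simp: S_def)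
  define s where "s = Sup S"
  have le: "norm (T x) \<le> s * norm x" if "x \<in> M" for x
  proof (cases "x = 0")
    case False
    have "norm (T ((1 / norm x) *\<^sub>R x)) \<le> s"
      unfolding s_def using unit[OF that False] by (intro cSup_upper bdd) (auto simp: S_def)
    then show ?thesis using False by (simp add: blinfun.scaleR_right field_simps)
  qed (simp add: blinfun.zero_right)
  have s0: "s > 0"
    using le[OF x0(1)] x0 x0' by (metis less_le_trans linorder_not_less mult_nonpos_nonneg norm_ge_zero norm_le_zero_iff)
  have "\<exists>x\<in>M. norm x = 1 \<and> s - inverse (real (Suc n)) < norm (T x)" for n
  proof -
    have "s - inverse (real (Suc n)) < Sup S" by (simp add: s_def)
    then show ?thesis using less_cSup_iff[OF Sne bdd] by (auto simp: S_def)
  qed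
  then obtain x where x: "\<And>n. x n \<in> M" "\<And>n. norm (x n) = 1" "\<And>n. s - inverse (real (Suc n)) < norm (T (x n))"
    by metis
  have lim: "(\<lambda>n. norm (T (x n))) \<longlonglongrightarrow> s"
  proof (rule tendsto_sandwich[where f="\<lambda>n. s - inverse (real (Suc n))" and h="\<lambda>_. s"])
    show "\<forall>\<^sub>F n in sequentially. norm (T (x n)) \<le> s"
      using le[OF x(1)] x(2) by (intro always_eventually) auto
    show "(\<lambda>n. s - inverse (real (Suc n))) \<longlonglongrightarrow> s"
      using tendsto_diff[OF tendsto_const LIMSEQ_inverse_real_of_nat, of s] by simp
    show "\<forall>\<^sub>F n in sequentially. s - inverse (real (Suc n)) \<le> norm (T (x n))"
      using x(3) by (intro always_eventually allI less_imp_le)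
  qed simp
  obtain l \<phi> where \<phi>: "strict_mono (\<phi> :: nat \<Rightarrow> nat)" "(\<lambda>n. T (x (\<phi> n))) \<longlonglongrightarrow> l"
    by (rule compact_op_subseq[OF T, of x]) (use x(2) in auto)
  define y where "y = (\<lambda>n. x (\<phi> n))"
  have y: "\<And>n. y n \<in> M" "\<And>n. norm (y n) = 1" "(\<lambda>n. T (y n)) \<longlonglongrightarrow> l"
    using x \<phi> by (auto simp: y_def)
  have ls: "norm l = s"
    using LIMSEQ_subseq_LIMSEQ[OF lim \<phi>(1)] tendsto_norm[OF \<phi>(2)]
    by (auto simp: o_def intro: LIMSEQ_unique)
  have "Cauchy y"
  proof (rule metric_CauchyI)
    fix \<epsilon> :: real assume \<epsilon>: "\<epsilon> > 0"
    \<comment> \<open>The parallelogram law will give a squared distance of at most 4 \<eta> =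
      \<epsilon>^2 / 2.\<close>
    define \<eta> where "\<eta> = \<epsilon>\<^sup>2 / 8"
    have \<eta>: "\<eta> > 0" using \<epsilon> by (simp add: \<eta>_def)
    then obtain L where L: "\<And>n. n \<ge> L \<Longrightarrow> norm (T (y n) - l) < \<eta> * s / 2"
      using LIMSEQ_D[OF y(3), of "\<eta> * s / 2"] s0 by auto
    have "dist (y m) (y n) < \<epsilon>" if mn: "m \<ge> L" "n \<ge> L" for m n
    proof -
      have "2 * s = norm ((l - T (y m)) + (l - T (y n)) + (T (y m) + T (y n)))"
        using ls by (simp add: algebra_simps flip: scaleR_2)
      also have "\<dots> \<le> norm (l - T (y m)) + norm (l - T (y n)) + norm (T (y m) + T (y n))"
        by (intro norm_triangle_le add_right_mono norm_triangle_ineq)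
      also have "\<dots> \<le> \<eta> * s / 2 + \<eta> * s / 2 + s * norm (y m + y n)"
        using L[OF mn(1)] L[OF mn(2)] le[of "y m + y n"] y(1) M(1)
        by (intro add_mono) (auto simp: norm_minus_commute blinfun.add_right[symmetric] subspace_add)
      finally have "s * (2 - \<eta>) \<le> s * norm (y m + y n)" by (simp add: algebra_simps)
      then have ge: "2 - \<eta> \<le> norm (y m + y n)" using s0 by simp
      have "4 - 4 * \<eta> \<le> (norm (y m + y n))\<^sup>2"
      proof (cases "\<eta> \<le> 2")
        case True
        have "4 - 4 * \<eta> \<le> (2 - \<eta>)\<^sup>2" by (simp add: power2_eq_square algebra_simps)
        also have "\<dots> \<le> (norm (y m + y n))\<^sup>2" using ge True by (intro power_mono) auto
        finally show ?thesis .
      next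
        case False then show ?thesis
          using zero_le_power2[of "norm (y m + y n)"] by linarith
      qed
      then have "(norm (y m - y n))\<^sup>2 \<le> 4 * \<eta>"
        using parallelogram_law[of "y m" "y n"] y(2) by simp
      also have "\<dots> < \<epsilon>\<^sup>2" using \<epsilon> by (simp add: \<eta>_def)
      finally show ?thesis
        unfolding dist_norm using \<epsilon> by (intro power2_less_imp_less[of _ \<epsilon>]) simp_all
    qed
    then show "\<exists>L. \<forall>m\<ge>L. \<forall>n\<ge>L. dist (y m) (y n) < \<epsilon>" by blast
  qed
  then obtain e where e: "y \<longlonglongrightarrow> e"
    using Cauchy_convergent_iff convergent_def by blast
  have "e \<in> M" using closed_sequentially[OF M(2) _ e] y(1) by blast
  moreover have "norm e = 1"
    using tendsto_norm[OF e] y(2) by (simp add: LIMSEQ_const_iff)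
  moreover have "(\<lambda>n. T (y n)) \<longlonglongrightarrow> T e"
    by (intro tendsto_intros e)
  then have "T e = l" using y(3) LIMSEQ_unique by blast
  ultimately show ?thesis using ls s0 le by (intro bexI[of _ e]) auto
qed

text \<open>A variational argument: if the images were not orthogonal, moving \<open>e\<close>
  slightly along \<open>x\<close> would increase the norm of the image to first order but the norm
  of the vector only to second order. It yields the orthogonality of the left singular
  vectors.\<close>

lemma maximizer_orthogonal:
  fixes T :: "'a::complex_inner \<Rightarrow>\<^sub>L 'a"
  assumes T: "T \<in> bounded_ops"
    and max: "\<And>c. norm (T (e - c *\<^sub>C x)) \<le> norm (T e) * norm (e - c *\<^sub>C x)"
    and e: "norm e = 1" and ortho: "cinner x e = 0"
  shows "cinner (T x) (T e) = 0"
proof (rule ccontr)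
  define z where "z = cinner (T e) (T x)"
  assume "cinner (T x) (T e) \<noteq> 0"
  then have z: "z \<noteq> 0" using cinner_commute[of "T x" "T e"] by (simp add: z_def)
  define K where "K = (norm (T e))\<^sup>2 * (norm x)\<^sup>2"
  \<comment> \<open>The first-order gain is 2 t |z|^2 and the second-order cost at most t^2 |z|^2 K,
    so \<open>t * K < 1\<close> suffices for a contradiction.\<close>
  define t where "t = 1 / (K + 1)"
  have K: "K \<ge> 0" by (simp add: K_def)
  then have t: "t > 0" "t * K < 1" by (auto simp: t_def field_simps)
  define c where "c = - (of_real t * z)"
  have ex: "cinner e x = 0" using ortho cinner_commute[of e x] by simp
  have zz: "cnj z * z = of_real ((cmod z)\<^sup>2)"
    by (simp only: complex_norm_square mult.commute)
  have "(norm (T (e - c *\<^sub>C x)))\<^sup>2 \<le> (norm (T e) * norm (e - c *\<^sub>C x))\<^sup>2"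
    by (intro power_mono max) simp
  also have "\<dots> = (norm (T e))\<^sup>2 * (1 + (cmod c)\<^sup>2 * (norm x)\<^sup>2)"
    by (simp add: power_mult_distrib norm_diff_sq[of e] cinner_simps ex e norm_scaleC)
  also have "(norm (T (e - c *\<^sub>C x)))\<^sup>2 = (norm (T e))\<^sup>2 - 2 * Re (cnj c * z) + (cmod c)\<^sup>2 * (norm (T x))\<^sup>2"
    by (simp add: blinfun.diff_right bounded_ops_scaleC[OF T] norm_diff_sq[of "T e"] cinner_simps
        norm_scaleC z_def power_mult_distrib)
  also have "cnj c * z = of_real (- (t * (cmod z)\<^sup>2))"
    by (simp only: c_def complex_cnj_minus complex_cnj_mult complex_cnj_complex_of_real
        mult_minus_left mult.assoc zz of_real_mult of_real_minus)
  finally have "2 * (t * (cmod z)\<^sup>2) \<le> (cmod c)\<^sup>2 * K - (cmod c)\<^sup>2 * (norm (T x))\<^sup>2"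
    by (simp add: K_def algebra_simps)
  also have "\<dots> \<le> (cmod c)\<^sup>2 * K" by simp
  also have "(cmod c)\<^sup>2 * K = (t * (cmod z)\<^sup>2) * (t * K)"
    using t by (simp add: c_def norm_mult power2_eq_square)
  also have "\<dots> \<le> (t * (cmod z)\<^sup>2) * 1"
    using t by (intro mult_left_mono) auto
  finally show False using t z by simp
qed

text \<open>Padding with zero vectors where \<open>s j = 0\<close> gives finite and infinite rank
  the same format, matching the padding with zeros in \<open>singular_values\<close>. Completeness
  of \<open>e\<close> is not demanded; the kernel of \<open>T\<close> is simply unseen by the
  expansion.\<close>

definition svd :: "('a::complex_hilbert_space \<Rightarrow>\<^sub>L 'a) \<Rightarrow> (nat \<Rightarrow> real) \<Rightarrow> (nat \<Rightarrow> 'a) \<Rightarrow> (nat \<Rightarrow> 'a) \<Rightarrow> bool"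
  where "svd T s e f \<longleftrightarrow> decseq s \<and> (\<forall>j. 0 \<le> s j) \<and> s \<longlonglongrightarrow> 0 \<and> ortho_sys UNIV e \<and> ortho_sys UNIV f \<and>
    (\<forall>j. s j > 0 \<longrightarrow> norm (e j) = 1 \<and> norm (f j) = 1) \<and> (\<forall>j. s j = 0 \<longrightarrow> e j = 0 \<and> f j = 0) \<and>
    (\<forall>x. (\<lambda>j. s j *\<^sub>R (cinner x (e j) *\<^sub>C f j)) sums blinfun_apply T x)"

text \<open>A greedy choice: each vector maximizes the norm of the image on the orthogonal
  complement of its predecessors. Once \<open>T\<close> vanishes there the choice is 0, and the last
  clause then states just this vanishing.\<close>

lemma compact_op_svd_vectors:
  fixes T :: "'a::complex_hilbert_space \<Rightarrow>\<^sub>L 'a"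
  assumes T: "T \<in> bounded_ops" "compact_op T"
  shows "\<exists>e :: nat \<Rightarrow> 'a. \<forall>n. (\<forall>i<n. cinner (e n) (e i) = 0) \<and>
     (norm (e n) = 1 \<and> T (e n) \<noteq> 0 \<or> e n = 0) \<and>
     (\<forall>x. (\<forall>i<n. cinner x (e i) = 0) \<longrightarrow> norm (T x) \<le> norm (T (e n)) * norm x)"
proof (rule dependent_wellorder_choice)
  fix n :: nat and e :: "nat \<Rightarrow> 'a"
  define M where "M = {x. \<forall>i<n. cinner x (e i) = 0}"
  have "subspace M"
    unfolding M_def subspace_def by (auto simp: cinner_simps)
  moreover have "closed M"
  proof -
    have "closed {x. i < n \<longrightarrow> cinner x (e i) = 0}" for i
      by (cases "i < n") (auto intro!: closed_Collect_eq continuous_intros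
        bounded_linear.continuous_on[OF bounded_linear_cinner_left])
    then show ?thesis unfolding M_def by (intro closed_Collect_all)
  qed
  ultimately show "\<exists>r. (\<forall>i<n. cinner r (e i) = 0) \<and>
     (norm r = 1 \<and> T r \<noteq> 0 \<or> r = 0) \<and>
     (\<forall>x. (\<forall>i<n. cinner x (e i) = 0) \<longrightarrow> norm (T x) \<le> norm (T r) * norm x)"
  proof (cases "\<exists>x\<in>M. T x \<noteq> 0")
    case True
    then show ?thesis
      using compact_op_maximizer[OF T(2) \<open>subspace M\<close> \<open>closed M\<close>] unfolding M_def by blast
  next
    case False
    then show ?thesis unfolding M_def by (intro exI[of _ 0]) auto
  qed
qed auto

lemma compact_op_has_svd:
  fixes T :: "'a::complex_hilbert_space \<Rightarrow>\<^sub>L 'a"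
  assumes T: "T \<in> bounded_ops" "compact_op T"
  shows "\<exists>s e f. svd T s e f"
proof -
  obtain e :: "nat \<Rightarrow> 'a" where e1: "\<And>n i. i < n \<Longrightarrow> cinner (e n) (e i) = 0"
    and e2: "\<And>n. norm (e n) = 1 \<and> T (e n) \<noteq> 0 \<or> e n = 0"
    and e3: "\<And>n x. (\<And>i. i < n \<Longrightarrow> cinner x (e i) = 0) \<Longrightarrow> norm (T x) \<le> norm (T (e n)) * norm x"
    using compact_op_svd_vectors[OF T] by metis
  define s where "s = (\<lambda>n. norm (T (e n)))"
  define f where "f = (\<lambda>n. (1 / s n) *\<^sub>R T (e n))"
  have eo: "cinner (e i) (e j) = 0" if "i \<noteq> j" for i j
    using e1[of i j] e1[of j i] cinner_commute[of "e i" "e j"] that by (cases "i < j") auto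
  have ortho_e: "ortho_sys UNIV e"
    using eo e2 by (auto simp: ortho_sys_def)
  have en: "norm (e n) \<le> 1" for n using e2[of n] by auto
  have Teo: "cinner (T (e j)) (T (e i)) = 0" if "i < j" for i j
  proof (cases "e i = 0")
    case False
    show ?thesis
    proof (rule maximizer_orthogonal[OF T(1)])
      show "norm (T (e i - c *\<^sub>C e j)) \<le> norm (T (e i)) * norm (e i - c *\<^sub>C e j)" for c
        using that by (intro e3) (auto simp: cinner_simps eo)
    qed (use False e2[of i] e1[OF that] in auto)
  qed (simp add: blinfun.zero_right)
  have To: "cinner (T (e i)) (T (e j)) = 0" if "i \<noteq> j" for i j
    using Teo[of i j] Teo[of j i] cinner_commute[of "T (e i)" "T (e j)"] that by (cases "i < j") auto
  have s0: "s n \<ge> 0" for n by (simp add: s_def)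
  have szero: "e n = 0" "f n = 0" if "s n = 0" for n
    using that e2[of n] by (auto simp: s_def f_def)
  have spos: "norm (e n) = 1" "norm (f n) = 1" if "s n > 0" for n
    using that e2[of n] by (auto simp: s_def f_def blinfun.zero_right)
  have ortho_f: "ortho_sys UNIV f"
    unfolding ortho_sys_def
  proof (intro conjI ballI impI)
    fix i show "norm (f i) = 0 \<or> norm (f i) = 1"
      using s0[of i] szero(2)[of i] spos(2)[of i] by (auto simp: less_le)
  qed (simp add: f_def cinner_simps To)
  have dec: "decseq s"
  proof (rule decseq_SucI)
    fix n
    have "s (Suc n) \<le> s n * norm (e (Suc n))"
      unfolding s_def by (intro e3) (auto simp: eo)
    also have "\<dots> \<le> s n * 1" using en s0 by (intro mult_left_mono) auto
    finally show "s (Suc n) \<le> s n" by simp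
  qed
  obtain L where L: "s \<longlonglongrightarrow> L" "\<And>n. L \<le> s n"
    using decseq_convergent[OF dec, of 0] s0 by auto
  have "L \<ge> 0" using LIMSEQ_le_const[OF L(1)] s0 by blast
  \<comment> \<open>The images \<open>T (e n)\<close> are pairwise orthogonal; with norms at least
    \<open>L > 0\<close> they would stay at distance at least \<open>L\<close>, so no subsequence
    could converge, against compactness.\<close>
  have "L = 0"
  proof (rule ccontr)
    assume "L \<noteq> 0"
    with \<open>L \<ge> 0\<close> have Lp: "L > 0" by simp
    obtain l \<phi> where \<phi>: "strict_mono (\<phi> :: nat \<Rightarrow> nat)" "(\<lambda>n. T (e (\<phi> n))) \<longlonglongrightarrow> l"
      by (rule compact_op_subseq[where x=e, OF T(2) en])
    from metric_CauchyD[OF LIMSEQ_imp_Cauchy[OF this(2)] Lp] obtain m where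
      "\<forall>i\<ge>m. \<forall>j\<ge>m. dist (T (e (\<phi> i))) (T (e (\<phi> j))) < L" ..
    then have m: "dist (T (e (\<phi> m))) (T (e (\<phi> (Suc m)))) < L" by simp
    have "\<phi> m \<noteq> \<phi> (Suc m)" using strict_monoD[OF \<phi>(1), of m "Suc m"] by linarith
    then have "(norm (T (e (\<phi> m)) - T (e (\<phi> (Suc m)))))\<^sup>2 = (s (\<phi> m))\<^sup>2 + (s (\<phi> (Suc m)))\<^sup>2"
      by (simp add: norm_diff_sq To s_def)
    also have "\<dots> \<ge> L\<^sup>2"
      using power_mono[OF L(2) \<open>L \<ge> 0\<close>, of 2 "\<phi> m"] by (simp add: add_increasing2)
    finally have "L \<le> norm (T (e (\<phi> m)) - T (e (\<phi> (Suc m))))"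
      by (rule power2_le_imp_le) simp
    then show False using m by (simp add: dist_norm)
  qed
  with L have lim: "s \<longlonglongrightarrow> 0" by simp
  have sums: "(\<lambda>j. s j *\<^sub>R (cinner x (e j) *\<^sub>C f j)) sums T x" for x
  proof -
    define y where "y = (\<lambda>n. \<Sum>j<n. cinner x (e j) *\<^sub>C e j)"
    have "norm (T x - (\<Sum>j<n. s j *\<^sub>R (cinner x (e j) *\<^sub>C f j))) \<le> s n * (2 * norm x)" for n
    proof -
      have "s j *\<^sub>R (cinner x (e j) *\<^sub>C f j) = T (cinner x (e j) *\<^sub>C e j)" for j
      proof (cases "s j = 0")
        case True then show ?thesis by (simp add: szero blinfun.zero_right)
      next
        case False
        then have "T (e j) = s j *\<^sub>R f j" by (simp add: f_def)
        then show ?thesis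
          by (simp add: bounded_ops_scaleC[OF T(1)] scaleR_scaleC scaleC_scaleC mult.commute)
      qed
      then have "T x - (\<Sum>j<n. s j *\<^sub>R (cinner x (e j) *\<^sub>C f j)) = T (x - y n)"
        by (simp add: y_def blinfun.diff_right blinfun.sum_right)
      \<comment> \<open>The remainder is orthogonal to the first \<open>n\<close> vectors, so the
        maximality of \<open>e n\<close> controls it by \<open>s n\<close>, which tends to
        0.\<close>
      moreover have "norm (T (x - y n)) \<le> s n * norm (x - y n)"
        unfolding s_def
      proof (rule e3)
        fix i assume i: "i < n"
        have "cinner (y n) (e i) = (\<Sum>j<n. if j = i then cinner x (e i) * of_real ((norm (e i))\<^sup>2) else 0)"
          unfolding y_def cinner_sum_left
          by (intro sum.cong refl) (auto simp: cinner_simps ortho_sys_cinner[OF ortho_e])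
        also have "\<dots> = cinner x (e i)" using i e2[of i] by auto
        finally show "cinner (x - y n) (e i) = 0" by (simp add: cinner_simps)
      qed
      moreover have "norm (x - y n) \<le> 2 * norm x"
      proof -
        have o: "ortho_sys {..<n} e" using ortho_sys_subset[OF ortho_e] by simp
        have "(norm (y n))\<^sup>2 \<le> (norm x)\<^sup>2"
          unfolding y_def using ortho_sys_norm_sum_le[OF o] bessel[OF o] by (meson finite_lessThan order_trans)
        then have "norm (y n) \<le> norm x" by (rule power2_le_imp_le) simp
        then show ?thesis using norm_triangle_ineq4[of x "y n"] by linarith
      qed
      ultimately show ?thesis using s0[of n] by (metis mult_left_mono order_trans)
    qed
    moreover have "(\<lambda>n. s n * (2 * norm x)) \<longlonglongrightarrow> 0"
      using tendsto_mult_right[OF lim] by simp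
    ultimately have "(\<lambda>n. T x - (\<Sum>j<n. s j *\<^sub>R (cinner x (e j) *\<^sub>C f j))) \<longlonglongrightarrow> 0"
      by (rule Lim_null_comparison[OF always_eventually[OF allI]])
    then have "(\<lambda>n. T x - (T x - (\<Sum>j<n. s j *\<^sub>R (cinner x (e j) *\<^sub>C f j)))) \<longlonglongrightarrow> T x - 0"
      by (intro tendsto_diff tendsto_const)
    then show ?thesis unfolding sums_def by simp
  qed
  have "svd T s e f"
    unfolding svd_def by (intro conjI allI impI dec s0 lim ortho_e ortho_f spos szero sums)
  then show ?thesis by blast
qed

text \<open>By Bessel the block of terms from \<open>m\<close> to \<open>n\<close> has operator norm
  at most \<open>s m\<close>, so the partial sums converge in operator norm. It provides the
  witnesses for the adjoint and the modulus.\<close>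

lemma diagonal_operator:
  fixes a b :: "nat \<Rightarrow> 'a::complex_hilbert_space"
  assumes s: "decseq s" "\<And>j. 0 \<le> s j" "s \<longlonglongrightarrow> 0"
    and a: "ortho_sys UNIV a" and b: "ortho_sys UNIV b"
  shows "\<exists>P \<in> bounded_ops. \<forall>x. (\<lambda>j. s j *\<^sub>R (cinner x (a j) *\<^sub>C b j)) sums blinfun_apply P x"
proof -
  define R where "R = (\<lambda>j. Blinfun (\<lambda>x. s j *\<^sub>R (cinner x (a j) *\<^sub>C b j)))"
  have "bounded_linear (\<lambda>x. s j *\<^sub>R (cinner x (a j) *\<^sub>C b j))" for j
    by (intro bounded_linear_compose[OF bounded_linear_scaleR_right]
        bounded_linear_compose[OF bounded_linear_scaleC_left] bounded_linear_cinner_left)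
  then have R: "blinfun_apply (R j) x = s j *\<^sub>R (cinner x (a j) *\<^sub>C b j)" for j x
    by (simp add: R_def bounded_linear_Blinfun_apply)
  define P where "P = (\<lambda>n. \<Sum>j<n. R j)"
  have diff: "norm (P n - P m) \<le> s m" if "m \<le> n" for m n
  proof (rule norm_blinfun_bound)
    fix x
    have oa: "ortho_sys {m..<n} a" and ob: "ortho_sys {m..<n} b"
      using a b by (auto intro: ortho_sys_subset)
    have "{..<n} = {..<m} \<union> {m..<n}" using that by auto
    then have "P n = P m + (\<Sum>j=m..<n. R j)"
      unfolding P_def by (simp add: sum.union_disjoint ivl_disj_int)
    then have "(P n - P m) x = (\<Sum>j=m..<n. (of_real (s j) * cinner x (a j)) *\<^sub>C b j)"
      by (simp add: blinfun.sum_left R scaleR_scaleC scaleC_scaleC)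
    then have "(norm ((P n - P m) x))\<^sup>2 \<le> (\<Sum>j=m..<n. (cmod (of_real (s j) * cinner x (a j)))\<^sup>2)"
      using ortho_sys_norm_sum_le[OF ob] by simp
    also have "\<dots> \<le> (\<Sum>j=m..<n. (s m)\<^sup>2 * (cmod (cinner x (a j)))\<^sup>2)"
      using s decseqD[OF s(1)]
      by (intro sum_mono) (auto simp: norm_mult power_mult_distrib intro!: mult_right_mono power_mono)
    also have "\<dots> \<le> (s m)\<^sup>2 * (norm x)\<^sup>2"
      unfolding sum_distrib_left[symmetric] by (intro mult_left_mono bessel oa) auto
    finally have "(norm ((P n - P m) x))\<^sup>2 \<le> (s m * norm x)\<^sup>2"
      by (simp only: power_mult_distrib)
    then show "norm ((P n - P m) x) \<le> s m * norm x"
      by (rule power2_le_imp_le) (simp add: s)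
  qed (use s in auto)
  have "Cauchy P"
    unfolding Cauchy_altdef2
  proof (intro allI impI)
    fix \<epsilon> :: real assume "\<epsilon> > 0"
    then obtain L where "norm (s L - 0) < \<epsilon>" using LIMSEQ_D[OF s(3)] by blast
    then have "s L < \<epsilon>" using s(2)[of L] by simp
    then have "\<forall>n\<ge>L. dist (P n) (P L) < \<epsilon>"
      unfolding dist_norm using diff[of L] le_less_trans by blast
    then show "\<exists>N. \<forall>n\<ge>N. dist (P n) (P N) < \<epsilon>" by blast
  qed
  then obtain D where D: "P \<longlonglongrightarrow> D" using Cauchy_convergent_iff convergent_def by blast
  have sums: "(\<lambda>j. s j *\<^sub>R (cinner x (a j) *\<^sub>C b j)) sums D x" for x
    unfolding sums_def using blinfun.tendsto[OF D tendsto_const, of x]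
    by (simp add: P_def blinfun.sum_left R)
  have "D \<in> bounded_ops"
    unfolding bounded_ops_def
  proof (clarify)
    fix c x
    have "(\<lambda>j. c *\<^sub>C (s j *\<^sub>R (cinner x (a j) *\<^sub>C b j))) sums (c *\<^sub>C D x)"
    proof (rule bounded_linear.sums[OF _ sums])
      show "bounded_linear (\<lambda>x::'a. c *\<^sub>C x)"
        by (rule bounded_linear_intro[where K="cmod c"])
          (simp_all add: scaleC_add_right norm_scaleC scaleR_scaleC scaleC_scaleC mult.commute)
    qed
    moreover have "(\<lambda>j. c *\<^sub>C (s j *\<^sub>R (cinner x (a j) *\<^sub>C b j))) = (\<lambda>j. s j *\<^sub>R (cinner (c *\<^sub>C x) (a j) *\<^sub>C b j))"
      by (simp add: scaleR_scaleC scaleC_scaleC cinner_simps mult_ac)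
    ultimately show "D (c *\<^sub>C x) = c *\<^sub>C D x"
      using sums[of "c *\<^sub>C x"] sums_unique2 by metis
  qed
  then show ?thesis using sums by blast
qed

section \<open>Adjoint and modulus read off from a singular value decomposition\<close>

lemma sums_cinner_left: "f sums l \<Longrightarrow> (\<lambda>j. cinner (f j) y) sums cinner l (y::'a::complex_inner)"
  by (rule bounded_linear.sums[OF bounded_linear_cinner_left])

lemma sums_cinner_right: "f sums l \<Longrightarrow> (\<lambda>j. cinner y (f j)) sums cinner (y::'a::complex_inner) l"
  by (rule bounded_linear.sums[OF bounded_linear_cinner_right])

lemma sums_single_unique:
  fixes l :: "'a::{t2_space, comm_monoid_add}"
  assumes "f sums l" and "\<And>j. f j = (if j = k then c else 0)"
  shows "l = c"
proof -
  have "f = (\<lambda>j. if j = k then c else 0)" using assms(2) by (rule ext)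
  then show ?thesis using assms(1) sums_single[of k "\<lambda>_. c"] by (simp add: sums_unique2)
qed

lemma diagonal_operator_coefficient:
  assumes D: "(\<lambda>j. s j *\<^sub>R (cinner x (a j) *\<^sub>C b j)) sums y"
    and b: "ortho_sys UNIV b" "s k \<noteq> 0 \<Longrightarrow> norm (b k) = 1"
  shows "cinner y (b k) = of_real (s k) * cinner x (a k :: 'a::complex_inner)"
  using sums_cinner_left[OF D, of "b k"]
  by (rule sums_single_unique) (use b(2) in \<open>auto simp: cinner_simps ortho_sys_cinner[OF b(1)]\<close>)

lemma svdD:
  assumes "svd T s e f"
  shows "decseq s" "\<And>j. 0 \<le> s j" "s \<longlonglongrightarrow> 0" "ortho_sys UNIV e" "ortho_sys UNIV f"
    "\<And>j. s j \<noteq> 0 \<Longrightarrow> norm (e j) = 1" "\<And>j. s j \<noteq> 0 \<Longrightarrow> norm (f j) = 1"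
    "\<And>j. s j = 0 \<Longrightarrow> e j = 0" "\<And>j. s j = 0 \<Longrightarrow> f j = 0"
    "\<And>x. (\<lambda>j. s j *\<^sub>R (cinner x (e j) *\<^sub>C f j)) sums blinfun_apply T x"
  using assms unfolding svd_def by (auto simp: less_le)

text \<open>Exchanging \<open>e\<close> and \<open>f\<close> in the expansion gives an operator with
  the defining property; inner products determine it uniquely, which resolves the definite
  description.\<close>

lemma svd_adjoint:
  assumes "svd T s e f"
  shows "adjoint_op T \<in> bounded_ops"
    and "(\<lambda>j. s j *\<^sub>R (cinner y (f j) *\<^sub>C e j)) sums blinfun_apply (adjoint_op T) y"
proof -
  note d = svdD[OF assms]
  obtain S where S: "S \<in> bounded_ops" "\<And>y. (\<lambda>j. s j *\<^sub>R (cinner y (f j) *\<^sub>C e j)) sums blinfun_apply S y"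
    using diagonal_operator[OF d(1,2,3,5,4)] by auto
  have adj: "cinner (T x) y = cinner x (S y)" for x y
  proof -
    have "cinner (f j) y = cnj (cinner y (f j))" for j by (rule cinner_commute)
    then have "(\<lambda>j. cinner (s j *\<^sub>R (cinner x (e j) *\<^sub>C f j)) y) = (\<lambda>j. cinner x (s j *\<^sub>R (cinner y (f j) *\<^sub>C e j)))"
      by (simp add: cinner_simps mult_ac)
    then show ?thesis
      using sums_cinner_left[OF d(10), of x y] sums_cinner_right[OF S(2), of x y] sums_unique2 by metis
  qed
  have "adjoint_op T = S"
    unfolding adjoint_op_def
  proof (rule the_equality)
    show "S \<in> bounded_ops \<and> (\<forall>x y. cinner (T x) y = cinner x (S y))" using S adj by blast
    fix S' assume S': "S' \<in> bounded_ops \<and> (\<forall>x y. cinner (T x) y = cinner x (S' y))"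
    show "S' = S"
    proof (rule blinfun_eqI, rule cinner_eqI)
      fix y z
      have "cinner z (S' y) = cinner z (S y)" using adj S' by metis
      then show "cinner (S' y) z = cinner (S y) z" by (metis cinner_commute)
    qed
  qed
  then show "adjoint_op T \<in> bounded_ops"
    "(\<lambda>j. s j *\<^sub>R (cinner y (f j) *\<^sub>C e j)) sums blinfun_apply (adjoint_op T) y"
    using S by simp_all
qed

text \<open>Polarization: the quadratic form is real at x + y and at x + i y, which fixes the
  imaginary and the real part.\<close>

lemma positive_op_selfadjoint:
  assumes "positive_op Q"
  shows "cinner (Q x) y = cinner x (Q y)"
proof -
  have Q: "Q \<in> bounded_ops" and pos: "\<And>x. cinner (Q x) x \<in> \<real>\<^sub>\<ge>\<^sub>0"
    using assms unfolding positive_op_def by blast+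
  have im: "Im (cinner (Q x) x) = 0" for x
    using pos[of x] by (simp add: complex_nonneg_Reals_iff)
  have "Im (cinner (Q x) y + cinner (Q y) x) = 0"
    using im[of "x + y"] im[of x] im[of y] by (simp add: blinfun.add_right cinner_simps)
  moreover have "Re (cinner (Q x) y) = Re (cinner (Q y) x)"
    using im[of "x + \<i> *\<^sub>C y"] im[of x] im[of y]
    by (simp add: blinfun.add_right cinner_simps bounded_ops_scaleC[OF Q])
  ultimately have "cinner (Q x) y = cnj (cinner (Q y) x)"
    by (simp add: complex_eq_iff)
  then show ?thesis using cinner_commute[of x "Q y"] by simp
qed

text \<open>
  A positive \<open>Q\<close> with \<open>Q\<^sup>2 = P\<^sup>2\<close> agrees with \<open>P\<close> on the eigenvectors because \<open>Q + s\<^sub>j\<close> is injective, and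
  \<open>\<parallel>Q x\<parallel> = \<parallel>P x\<parallel>\<close> handles the limit.
\<close>

lemma positive_sqrt_unique:
  assumes P: "positive_op P" and Q: "positive_op Q" and eq: "Q o\<^sub>L Q = P o\<^sub>L P"
    and s: "\<And>j. 0 \<le> s j" "\<And>j. s j = 0 \<Longrightarrow> e j = 0"
    and Pe: "\<And>j. P (e j) = s j *\<^sub>R e j"
    and Px: "\<And>x. (\<lambda>j. s j *\<^sub>R (cinner x (e j) *\<^sub>C e j)) sums blinfun_apply P x"
  shows "Q = P"
proof (rule blinfun_eqI)
  fix x
  have QQ: "Q (Q x) = P (P x)" for x
    using eq by (metis blinfun_apply_blinfun_compose)
  have lin: "P \<in> bounded_ops" "Q \<in> bounded_ops" using P Q by (auto simp: positive_op_def)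
  have Qe: "Q (e j) = s j *\<^sub>R e j" for j
  proof (cases "s j = 0")
    case True then show ?thesis by (simp add: s blinfun.zero_right)
  next
    case False
    define y where "y = Q (e j) - s j *\<^sub>R e j"
    have "Q y = - (s j *\<^sub>R y)"
      by (simp add: y_def blinfun.diff_right blinfun.scaleR_right QQ Pe algebra_simps)
    then have "cinner (Q y) y = of_real (- (s j * (norm y)\<^sup>2))"
      by (simp add: cinner_simps cinner_self)
    moreover have "cinner (Q y) y \<in> \<real>\<^sub>\<ge>\<^sub>0" using Q by (simp add: positive_op_def)
    ultimately have "s j * (norm y)\<^sup>2 \<le> 0"
      by (metis complex_nonneg_Reals_iff Re_complex_of_real neg_0_le_iff_le)
    then have "y = 0" using s(1)[of j] False by (simp add: mult_le_0_iff)
    then show ?thesis by (simp add: y_def)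
  qed
  have nrm: "norm (Q z) = norm (P z)" for z
  proof -
    have "cinner (Q z) (Q z) = cinner (P z) (P z)"
      using positive_op_selfadjoint[OF Q, of "Q z" z] positive_op_selfadjoint[OF P, of "P z" z] QQ[of z]
      by (metis)
    then have "(norm (Q z))\<^sup>2 = (norm (P z))\<^sup>2" by (simp only: norm_sq_cinner)
    then show ?thesis by simp
  qed
  define y where "y = (\<lambda>n. \<Sum>j<n. cinner x (e j) *\<^sub>C e j)"
  have Py: "P (y n) = (\<Sum>j<n. s j *\<^sub>R (cinner x (e j) *\<^sub>C e j))" for n
    by (simp add: y_def blinfun.sum_right bounded_ops_scaleC[OF lin(1)] Pe scaleR_scaleC scaleC_scaleC mult.commute)
  have Qy: "Q (y n) = P (y n)" for n
    unfolding Py by (simp add: y_def blinfun.sum_right bounded_ops_scaleC[OF lin(2)] Qe scaleR_scaleC scaleC_scaleC mult.commute)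
  have lim: "(\<lambda>n. P (y n)) \<longlonglongrightarrow> P x"
    using Px[of x] unfolding sums_def Py .
  have "(\<lambda>n. norm (P x - P (y n))) \<longlonglongrightarrow> norm (P x - P x)"
    by (intro tendsto_intros lim)
  then have "(\<lambda>n. norm (Q x - P (y n))) \<longlonglongrightarrow> 0"
    using nrm[of "x - y _"] by (simp add: blinfun.diff_right Qy)
  then have "(\<lambda>n. Q x - P (y n)) \<longlonglongrightarrow> 0" by (rule tendsto_norm_zero_cancel)
  then have "(\<lambda>n. Q x - (Q x - P (y n))) \<longlonglongrightarrow> Q x - 0" by (intro tendsto_diff tendsto_const)
  then have "(\<lambda>n. P (y n)) \<longlonglongrightarrow> Q x" by simp
  then show "Q x = P x" using lim LIMSEQ_unique by blast
qed

text \<open>The operator with eigenvectors \<open>e j\<close> and eigenvalues \<open>s j\<close> is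
  a positive square root of the required product, and \<open>positive_sqrt_unique\<close> makes it
  the only one.\<close>

lemma svd_abs_op:
  assumes "svd T s e f"
  shows "abs_op T \<in> bounded_ops"
    and "(\<lambda>j. s j *\<^sub>R (cinner x (e j) *\<^sub>C e j)) sums blinfun_apply (abs_op T) x"
proof -
  note d = svdD[OF assms]
  obtain P where P: "P \<in> bounded_ops" "\<And>y. (\<lambda>j. s j *\<^sub>R (cinner y (e j) *\<^sub>C e j)) sums blinfun_apply P y"
    using diagonal_operator[OF d(1,2,3,4,4)] by auto
  have pos: "positive_op P"
    unfolding positive_op_def
  proof (intro conjI allI P)
    fix x
    have "(\<lambda>j. cinner (s j *\<^sub>R (cinner x (e j) *\<^sub>C e j)) x) sums cinner (P x) x"
      by (rule sums_cinner_left[OF P(2)])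
    moreover have "cinner (s j *\<^sub>R (cinner x (e j) *\<^sub>C e j)) x = of_real (s j * (cmod (cinner x (e j)))\<^sup>2)" for j
    proof -
      have "cinner (e j) x = cnj (cinner x (e j))" by (rule cinner_commute)
      then show ?thesis
        by (simp only: cinner_simps complex_norm_square of_real_mult mult.assoc)
    qed
    ultimately have "(\<lambda>j. complex_of_real (s j * (cmod (cinner x (e j)))\<^sup>2)) sums cinner (P x) x" by simp
    then have re: "(\<lambda>j. s j * (cmod (cinner x (e j)))\<^sup>2) sums Re (cinner (P x) x)"
      and im: "(\<lambda>j. 0::real) sums Im (cinner (P x) x)"
      by (auto simp: sums_complex_iff)
    have "0 \<le> Re (cinner (P x) x)" by (rule sums_le[OF _ sums_zero re]) (simp add: d)
    moreover have "Im (cinner (P x) x) = 0" by (rule sums_unique2[OF im sums_zero])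
    ultimately show "cinner (P x) x \<in> \<real>\<^sub>\<ge>\<^sub>0" by (simp add: complex_nonneg_Reals_iff)
  qed
  have PP: "P o\<^sub>L P = adjoint_op T o\<^sub>L T"
  proof (rule blinfun_eqI)
    fix x
    \<comment> \<open>Both sides are \<open>s j\<close> times the coefficient of \<open>x\<close> at
      \<open>e j\<close>; hence the series for \<open>P (P x)\<close> and for the adjoint applied to
      \<open>T x\<close> agree term by term.\<close>
    have "cinner (P x) (e j) = cinner (T x) (f j)" for j
      using diagonal_operator_coefficient[OF P(2)[of x] d(4,6)]
        diagonal_operator_coefficient[OF d(10)[of x] d(5,7)] by simp
    then have "P (P x) = adjoint_op T (T x)"
      using P(2)[of "P x"] svd_adjoint(2)[OF assms, of "T x"] sums_unique2 by simp
    then show "(P o\<^sub>L P) x = (adjoint_op T o\<^sub>L T) x" by simp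
  qed
  have Pe: "P (e k) = s k *\<^sub>R e k" for k
    using P(2)[of "e k"]
  proof (rule sums_single_unique)
    show "s j *\<^sub>R (cinner (e k) (e j) *\<^sub>C e j) = (if j = k then s k *\<^sub>R e k else 0)" for j
      using d(6)[of k] by (cases "s k = 0") (auto simp: ortho_sys_cinner[OF d(4)] scaleC_one)
  qed
  have "abs_op T = P"
    unfolding abs_op_def
  proof (rule the_equality)
    show "positive_op P \<and> P o\<^sub>L P = adjoint_op T o\<^sub>L T" using pos PP by blast
    show "Q = P" if "positive_op Q \<and> Q o\<^sub>L Q = adjoint_op T o\<^sub>L T" for Q
      by (rule positive_sqrt_unique[OF pos _ _ d(2,8) Pe P(2)]) (use that PP in simp_all)
  qed
  then show "abs_op T \<in> bounded_ops"
    "(\<lambda>j. s j *\<^sub>R (cinner x (e j) *\<^sub>C e j)) sums blinfun_apply (abs_op T) x"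
    using P by simp_all
qed

section \<open>Singular values as eigenvalues of the modulus with multiplicity\<close>

lemma svd_finite_level:
  assumes "svd T s e f" "\<mu> > 0"
  shows "finite {j. s j = \<mu>}"
proof -
  have "\<forall>\<^sub>F j in sequentially. s j < \<mu>"
    using order_tendstoD(2)[OF svdD(3)[OF assms(1)] assms(2)] .
  then obtain L where "\<And>j. j \<ge> L \<Longrightarrow> s j < \<mu>" by (auto simp: eventually_sequentially)
  then have "{j. s j = \<mu>} \<subseteq> {..<L}" by (force simp: not_less[symmetric])
  then show ?thesis by (rule finite_subset) simp
qed

text \<open>The vectors \<open>e j\<close> with \<open>s j = \<mu>\<close> form a basis of the
  eigenspace. Positivity of \<mu> matters: an eigenvector is recovered from its image, whereas the
  kernel need not be spanned by the \<open>e j\<close>.\<close>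

lemma svd_dim_eigenspace:
  assumes svd: "svd T s e f" and \<mu>: "\<mu> > 0"
  shows "complex_vector.dim (eigenspace (abs_op T) (of_real \<mu>)) = card {j. s j = \<mu>}"
proof -
  note d = svdD[OF svd]
  define J where "J = {j. s j = \<mu>}"
  have fin: "finite J" unfolding J_def by (rule svd_finite_level[OF svd \<mu>])
  have e1: "norm (e j) = 1" if "j \<in> J" for j using d(6)[of j] that \<mu> by (simp add: J_def)
  have cj: "cinner (e i) (e j) = (if i = j then 1 else 0)" if "j \<in> J" for i j
    using e1[OF that] by (simp add: ortho_sys_cinner[OF d(4)])
  have inj: "inj_on e J"
  proof (rule inj_onI)
    fix i j assume "i \<in> J" "j \<in> J" "e i = e j"
    then show "i = j" using cj[of j i] cj[of j j] by (auto split: if_splits)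
  qed
  let ?E = "eigenspace (abs_op T) (of_real \<mu>)"
  have "complex_vector.dim ?E = card (e ` J)"
  proof (rule complex_vector.dim_unique[OF _ _ _ refl])
    show "e ` J \<subseteq> ?E"
    proof clarify
      fix k assume k: "k \<in> J"
      have "abs_op T (e k) = of_real \<mu> *\<^sub>C e k"
        using svd_abs_op(2)[OF svd, of "e k"]
      proof (rule sums_single_unique)
        show "s j *\<^sub>R (cinner (e k) (e j) *\<^sub>C e j) = (if j = k then of_real \<mu> *\<^sub>C e k else 0)" for j
          using k e1[OF k] by (auto simp: ortho_sys_cinner[OF d(4)] scaleC_one J_def scaleR_scaleC)
      qed
      then show "e k \<in> ?E" by (simp add: eigenspace_def)
    qed
    show "?E \<subseteq> complex_vector.span (e ` J)"
    proof
      fix x assume "x \<in> ?E"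
      then have x: "abs_op T x = of_real \<mu> *\<^sub>C x" by (simp add: eigenspace_def)
      \<comment> \<open>Comparing k-th coefficients in the eigenvalue equation gives \<mu> and
        \<open>s k\<close> as multipliers of the same number.\<close>
      have z: "cinner x (e k) = 0" if "k \<notin> J" for k
      proof -
        have "of_real \<mu> * cinner x (e k) = of_real (s k) * cinner x (e k)"
          using diagonal_operator_coefficient[OF svd_abs_op(2)[OF svd] d(4,6), of k x]
          by (simp add: x cinner_simps)
        moreover have "complex_of_real \<mu> \<noteq> of_real (s k)" using that by (auto simp: J_def)
        ultimately show ?thesis by (metis mult_right_cancel)
      qed
      have "(\<lambda>j. s j *\<^sub>R (cinner x (e j) *\<^sub>C e j)) sums (\<Sum>j\<in>J. s j *\<^sub>R (cinner x (e j) *\<^sub>C e j))"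
        by (rule sums_finite[OF fin]) (simp add: z)
      then have "of_real \<mu> *\<^sub>C x = (\<Sum>j\<in>J. s j *\<^sub>R (cinner x (e j) *\<^sub>C e j))"
        using svd_abs_op(2)[OF svd, of x] x sums_unique2 by metis
      also have "\<dots> \<in> complex_vector.span (e ` J)"
        unfolding scaleR_scaleC
        by (intro complex_vector.span_sum complex_vector.span_scale complex_vector.span_base) auto
      finally have "(1 / of_real \<mu>) *\<^sub>C (of_real \<mu> *\<^sub>C x) \<in> complex_vector.span (e ` J)"
        by (rule complex_vector.span_scale)
      then show "x \<in> complex_vector.span (e ` J)"
        using \<mu> by (simp add: scaleC_scaleC scaleC_one)
    qed
    show "complex_vector.independent (e ` J)"
    proof (rule complex_vector.independent_if_scalars_zero)
      fix c v assume sum: "(\<Sum>v\<in>e ` J. c v *\<^sub>C v) = 0" and "v \<in> e ` J"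
      then obtain k where k: "k \<in> J" "v = e k" by blast
      have "0 = cinner (\<Sum>j\<in>J. c (e j) *\<^sub>C e j) (e k)"
        using sum by (simp add: sum.reindex[OF inj])
      also have "\<dots> = (\<Sum>j\<in>J. if j = k then c (e k) else 0)"
        unfolding cinner_sum_left by (intro sum.cong refl) (auto simp: cinner_simps cj[OF k(1)])
      also have "\<dots> = c v" using k fin by simp
      finally show "c v = 0" by simp
    qed (use fin in simp)
  qed
  then show ?thesis unfolding card_image[OF inj] by (simp add: J_def)
qed

text \<open>At the first index where the sequences differ, the larger of the two values is positive.
  The sequence with the smaller entry can take that value only earlier, where both agree, so the
  other one takes it at least once more, contradicting equal multiplicities.\<close>

lemma decreasing_enumeration_unique:
  fixes s s' :: "nat \<Rightarrow> real"
  assumes s: "decseq s" "\<And>j. 0 \<le> s j" and s': "decseq s'" "\<And>j. 0 \<le> s' j"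
    and fin: "\<And>\<mu>. \<mu> > 0 \<Longrightarrow> finite {j. s j = \<mu>} \<and> finite {j. s' j = \<mu>} \<and> card {j. s j = \<mu>} = card {j. s' j = \<mu>}"
  shows "s = s'"
proof -
  have aux: "\<not> s j < s' j" if "decseq s" "\<And>j. 0 \<le> s j" "decseq s'"
    and fin: "\<And>\<mu>. \<mu> > 0 \<Longrightarrow> finite {j. s j = \<mu>} \<and> finite {j. s' j = \<mu>} \<and> card {j. s j = \<mu>} = card {j. s' j = \<mu>}"
    and eq: "\<And>i. i < j \<Longrightarrow> s i = s' i" for s s' :: "nat \<Rightarrow> real" and j
  proof
    assume less: "s j < s' j"
    define \<mu> where "\<mu> = s' j"
    have \<mu>: "\<mu> > 0" using that(2)[of j] less by (simp add: \<mu>_def)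
    have "{i. s i = \<mu>} \<subseteq> {i. i < j \<and> s' i = \<mu>}"
    proof clarify
      fix i assume "\<mu> = s i"
      moreover then have "i < j"
        using decseqD[OF that(1), of j i] less by (force simp: \<mu>_def not_le[symmetric])
      ultimately show "i < j \<and> s' i = s i" using eq by simp
    qed
    also have "\<dots> \<subset> {i. s' i = \<mu>}" by (auto simp: \<mu>_def)
    finally have "card {i. s i = \<mu>} < card {i. s' i = \<mu>}"
      using fin[OF \<mu>] by (intro psubset_card_mono) auto
    then show False using fin[OF \<mu>] by simp
  qed
  have "s j = s' j" for j
  proof (induction j rule: less_induct)
    case (less j)
    have "\<not> s j < s' j" by (rule aux[OF s s'(1) fin less])
    moreover have "\<not> s' j < s j" by (rule aux[OF s' s(1)]) (use fin less in auto)
    ultimately show ?case by simp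
  qed
  then show ?thesis by (rule ext)
qed

text \<open>Resolves the definite description of \<open>singular_values\<close>: the values of any
  decomposition satisfy it, and it has at most one solution.\<close>

lemma svd_singular_values:
  assumes "svd T s e f"
  shows "singular_values T = s"
  unfolding singular_values_def
proof (rule the_equality)
  note d = svdD[OF assms] and l = svd_finite_level[OF assms] svd_dim_eigenspace[OF assms]
  show *: "decseq s \<and> (\<forall>j. 0 \<le> s j) \<and> (\<forall>\<mu>>0. finite {j. s j = \<mu>} \<and>
      card {j. s j = \<mu>} = complex_vector.dim (eigenspace (abs_op T) (complex_of_real \<mu>)))"
    using d l by simp
  show "s' = s" if "decseq s' \<and> (\<forall>j. 0 \<le> s' j) \<and> (\<forall>\<mu>>0. finite {j. s' j = \<mu>} \<and>
      card {j. s' j = \<mu>} = complex_vector.dim (eigenspace (abs_op T) (complex_of_real \<mu>)))" for s'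
    by (rule decreasing_enumeration_unique) (use that * in auto)
qed

theorem singular_value_decomposition:
  assumes "T \<in> bounded_ops" "compact_op T"
  obtains e f where "svd T (singular_values T) e f"
  using compact_op_has_svd[OF assms] svd_singular_values that by metis

section \<open>Schatten classes\<close>

lemma bounded_ops_add: "S \<in> bounded_ops \<Longrightarrow> T \<in> bounded_ops \<Longrightarrow> S + T \<in> bounded_ops"
  by (simp add: bounded_ops_def blinfun.add_left scaleC_add_right)

lemma bounded_ops_scaleR: "T \<in> bounded_ops \<Longrightarrow> c *\<^sub>R T \<in> bounded_ops"
  by (simp add: bounded_ops_def blinfun.scaleR_left scaleR_scaleC scaleC_scaleC mult.commute)

lemma compact_op_add:
  fixes S T :: "'a::complex_inner \<Rightarrow>\<^sub>L 'a"
  assumes "compact_op S" "compact_op T"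
  shows "compact_op (S + T)"
proof -
  let ?C = "{x + y |x y. x \<in> closure (blinfun_apply S ` cball 0 1) \<and> y \<in> closure (blinfun_apply T ` cball 0 1)}"
  have C: "compact ?C"
    using assms unfolding compact_op_def by (rule compact_sums)
  have "blinfun_apply (S + T) ` cball 0 1 \<subseteq> ?C"
  proof (rule image_subsetI)
    fix z :: 'a assume z: "z \<in> cball 0 1"
    have "S z \<in> closure (blinfun_apply S ` cball 0 1)" "T z \<in> closure (blinfun_apply T ` cball 0 1)"
      by (rule subsetD[OF closure_subset imageI[OF z]])+
    then show "(S + T) z \<in> ?C" unfolding blinfun.add_left by blast
  qed
  then have sub: "closure (blinfun_apply (S + T) ` cball 0 1) \<subseteq> ?C"
    using compact_imp_closed[OF C] by (rule closure_minimal)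
  from compact_Int_closed[OF C closed_closure, of "blinfun_apply (S + T) ` cball 0 1"]
  show ?thesis
    unfolding compact_op_def Int_absorb1[OF sub] .
qed

lemma compact_op_scaleR:
  fixes T :: "'a::complex_inner \<Rightarrow>\<^sub>L 'a"
  assumes "compact_op T"
  shows "compact_op (c *\<^sub>R T)"
proof -
  let ?C = "(\<lambda>x. c *\<^sub>R x) ` closure (blinfun_apply T ` cball 0 1)"
  have C: "compact ?C"
    using assms unfolding compact_op_def by (rule compact_scaling)
  have "blinfun_apply (c *\<^sub>R T) ` cball 0 1 \<subseteq> ?C"
  proof (rule image_subsetI)
    fix z :: 'a assume z: "z \<in> cball 0 1"
    show "(c *\<^sub>R T) z \<in> ?C"
      unfolding blinfun.scaleR_left by (rule imageI[OF subsetD[OF closure_subset imageI[OF z]]])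
  qed
  then have sub: "closure (blinfun_apply (c *\<^sub>R T) ` cball 0 1) \<subseteq> ?C"
    using compact_imp_closed[OF C] by (rule closure_minimal)
  from compact_Int_closed[OF C closed_closure, of "blinfun_apply (c *\<^sub>R T) ` cball 0 1"]
  show ?thesis
    unfolding compact_op_def Int_absorb1[OF sub] .
qed

lemma compact_op_zero: "compact_op 0"
proof -
  have eq: "blinfun_apply 0 ` cball 0 1 = {0 :: 'a::complex_inner}"
    by (auto simp: image_iff intro!: bexI[of _ 0] exI[of _ 0])
  show ?thesis unfolding compact_op_def eq by simp
qed

lemma combination_compact_bounded_ops:
  assumes "\<And>i. i \<in> I \<Longrightarrow> A i \<in> bounded_ops \<and> compact_op (A i)"
  shows "(\<Sum>i\<in>I. t i *\<^sub>R A i) \<in> bounded_ops \<and> compact_op (\<Sum>i\<in>I. t i *\<^sub>R A i)"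
  using assms
proof (induction I rule: infinite_finite_induct)
  case (insert i I)
  then show ?case
    by (simp add: bounded_ops_add bounded_ops_scaleR compact_op_add compact_op_scaleR)
qed (simp_all add: compact_op_zero, simp_all add: bounded_ops_def)

section \<open>Diagonal coefficients and stability under linear combinations\<close>

lemma svd_cinner_sums:
  assumes "svd T s e f"
  shows "(\<lambda>j. of_real (s j) * (cinner x (e j) * cinner (f j) y)) sums cinner (T x) y"
  using sums_cinner_left[OF svdD(10)[OF assms], of x y] by (simp add: cinner_simps)

text \<open>Expresses singular values by coefficients that are linear in the operator once the
  vectors are fixed; this replaces Schatten duality. For \<open>s k = 0\<close> both vectors are 0,
  so no case is excluded.\<close>

lemma svd_diagonal:
  assumes "svd T s e f"
  shows "cinner (T (e k)) (f k) = of_real (s k)"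
  using diagonal_operator_coefficient[OF svdD(10)[OF assms] svdD(5,7)[OF assms], of k "e k"]
    svdD(6)[OF assms, of k] by (cases "s k = 0") (simp_all add: cinner_self)

text \<open>The weights \<open>W\<close> have row and column sums at most 1, and such a matrix is a
  contraction for the p-norm. Young's inequality proves this directly, at the price of a multiple of
  the left-hand side on the right.\<close>

lemma finite_diagonal_powr_sum_le:
  fixes s :: "'b \<Rightarrow> real"
  assumes fin: "finite F" "finite G" and p: "p > 1" and s: "\<And>j. j \<in> F \<Longrightarrow> 0 \<le> s j"
    and e: "ortho_sys F e" and f: "ortho_sys F f" and w: "ortho_sys G w" and x: "ortho_sys G x"
  shows "(\<Sum>b\<in>G. cmod (\<Sum>j\<in>F. of_real (s j) * (cinner (w b) (e j) * cinner (f j) (x b))) powr p)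
    \<le> (\<Sum>j\<in>F. s j powr p)"
proof -
  define g where "g = (\<lambda>b. cmod (\<Sum>j\<in>F. of_real (s j) * (cinner (w b) (e j) * cinner (f j) (x b))))"
  define W where "W = (\<lambda>b j. cmod (cinner (w b) (e j)) * cmod (cinner (f j) (x b)))"
  define q where "q = p / (p - 1)"
  have q: "q > 1" "1 / p + 1 / q = 1" "(p - 1) * q = p"
    using p by (auto simp: q_def field_simps)
  have g0: "g b \<ge> 0" for b by (simp add: g_def)
  have W0: "W b j \<ge> 0" for b j by (simp add: W_def)
  have gle: "g b \<le> (\<Sum>j\<in>F. s j * W b j)" for b
    unfolding g_def W_def by (intro sum_norm_le) (simp add: norm_mult s)
  have row: "(\<Sum>j\<in>F. W b j) \<le> 1" if "b \<in> G" for b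
    unfolding W_def using ortho_sys_norm_le[OF w that] ortho_sys_norm_le[OF x that]
    by (intro bessel_product e f fin)
  have col: "(\<Sum>b\<in>G. W b j) \<le> 1" if "j \<in> F" for j
  proof -
    have "(\<Sum>b\<in>G. W b j) = (\<Sum>b\<in>G. cmod (cinner (e j) (w b)) * cmod (cinner (x b) (f j)))"
      unfolding W_def by (intro sum.cong refl) (metis cinner_commute complex_mod_cnj)
    also have "\<dots> \<le> 1"
      using ortho_sys_norm_le[OF e that] ortho_sys_norm_le[OF f that]
      by (intro bessel_product w x fin)
    finally show ?thesis .
  qed
  have "(\<Sum>b\<in>G. g b powr p) \<le> (\<Sum>b\<in>G. \<Sum>j\<in>F. W b j * (s j powr p / p + g b powr p / q))"
  proof (intro sum_mono)
    fix b
    have "g b powr p = g b * g b powr (p - 1)"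
      using g0[of b] by (cases "g b = 0") (simp_all add: powr_diff)
    also have "\<dots> \<le> (\<Sum>j\<in>F. s j * W b j) * g b powr (p - 1)"
      using gle by (intro mult_right_mono) auto
    also have "\<dots> = (\<Sum>j\<in>F. W b j * (s j * g b powr (p - 1)))"
      by (simp add: sum_distrib_right sum_distrib_left mult_ac)
    also have "\<dots> \<le> (\<Sum>j\<in>F. W b j * (s j powr p / p + g b powr p / q))"
    proof (intro sum_mono mult_left_mono W0)
      fix j assume "j \<in> F"
      have "s j * g b powr (p - 1) \<le> s j powr p / p + (g b powr (p - 1)) powr q / q"
        by (rule Youngs_inequality) (use p q s \<open>j \<in> F\<close> in auto)
      then show "s j * g b powr (p - 1) \<le> s j powr p / p + g b powr p / q"
        by (simp add: powr_powr q)
    qed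
    finally show "g b powr p \<le> (\<Sum>j\<in>F. W b j * (s j powr p / p + g b powr p / q))" .
  qed
  also have "\<dots> = (\<Sum>j\<in>F. (\<Sum>b\<in>G. W b j) * (s j powr p / p)) + (\<Sum>b\<in>G. (\<Sum>j\<in>F. W b j) * (g b powr p / q))"
    unfolding distrib_left sum.distrib sum_distrib_right by (subst sum.swap) (rule refl)
  also have "\<dots> \<le> (\<Sum>j\<in>F. 1 * (s j powr p / p)) + (\<Sum>b\<in>G. 1 * (g b powr p / q))"
    using p q by (intro add_mono sum_mono mult_right_mono row col) auto
  also have "\<dots> = (\<Sum>j\<in>F. s j powr p) / p + (\<Sum>b\<in>G. g b powr p) / q"
    by (simp add: sum_divide_distrib)
  \<comment> \<open>The share 1/q of the left-hand side is absorbed; the remaining factor 1/p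
    cancels against the one on the right.\<close>
  finally have "(\<Sum>b\<in>G. g b powr p) * (1 - 1 / q) \<le> (\<Sum>j\<in>F. s j powr p) / p"
    by (simp add: algebra_simps)
  moreover have "1 - 1 / q = 1 / p" using q by simp
  ultimately show ?thesis using p by (simp add: g_def divide_right_mono field_simps)
qed

lemma svd_diagonal_powr_sum_le:
  assumes svd: "svd T s e f" and p: "p > 1" and sum: "summable (\<lambda>j. s j powr p)"
    and w: "ortho_sys G w" and x: "ortho_sys G x" and G: "finite G"
  shows "(\<Sum>b\<in>G. cmod (cinner (T (w b)) (x b)) powr p) \<le> (\<Sum>j. s j powr p)"
proof (rule LIMSEQ_le_const2)
  note d = svdD[OF svd]
  show "(\<lambda>m. \<Sum>b\<in>G. cmod (\<Sum>j<m. of_real (s j) * (cinner (w b) (e j) * cinner (f j) (x b))) powr p)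
      \<longlonglongrightarrow> (\<Sum>b\<in>G. cmod (cinner (T (w b)) (x b)) powr p)"
    using svd_cinner_sums[OF svd] p unfolding sums_def
    by (intro tendsto_sum tendsto_powr' tendsto_norm tendsto_const) auto
  have "(\<Sum>b\<in>G. cmod (\<Sum>j<m. of_real (s j) * (cinner (w b) (e j) * cinner (f j) (x b))) powr p)
      \<le> (\<Sum>j. s j powr p)" for m
  proof -
    have "(\<Sum>b\<in>G. cmod (\<Sum>j<m. of_real (s j) * (cinner (w b) (e j) * cinner (f j) (x b))) powr p)
      \<le> (\<Sum>j<m. s j powr p)"
      using d by (intro finite_diagonal_powr_sum_le p w x G ortho_sys_subset[OF d(4)] ortho_sys_subset[OF d(5)]) auto
    also have "\<dots> \<le> (\<Sum>j. s j powr p)"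
      by (intro sum_le_suminf sum) auto
    finally show ?thesis .
  qed
  then show "\<exists>N. \<forall>m\<ge>N. (\<Sum>b\<in>G. cmod (\<Sum>j<m. of_real (s j) * (cinner (w b) (e j) * cinner (f j) (x b))) powr p)
      \<le> (\<Sum>j. s j powr p)" by blast
qed

text \<open>Each term is at most the p-norm of the family. The crude constant is harmless, since the
  bound only serves to prove summability.\<close>

lemma powr_sum_le_card:
  fixes h :: "'i \<Rightarrow> real"
  assumes "finite I" "\<And>i. i \<in> I \<Longrightarrow> 0 \<le> h i" "p > 0"
  shows "(\<Sum>i\<in>I. h i) powr p \<le> real (card I) powr p * (\<Sum>i\<in>I. h i powr p)"
proof -
  define R where "R = (\<Sum>i\<in>I. h i powr p) powr (1 / p)"
  have R: "R \<ge> 0" "R powr p = (\<Sum>i\<in>I. h i powr p)"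
    using assms by (auto simp: R_def powr_powr sum_nonneg)
  have "h i \<le> R" if "i \<in> I" for i
  proof -
    have "h i = (h i powr p) powr (1 / p)" using assms that by (simp add: powr_powr)
    also have "\<dots> \<le> R"
      unfolding R_def using assms that by (intro powr_mono2 member_le_sum) auto
    finally show ?thesis .
  qed
  then have "(\<Sum>i\<in>I. h i) \<le> real (card I) * R"
    using sum_bounded_above[of I h R] by simp
  then have "(\<Sum>i\<in>I. h i) powr p \<le> (real (card I) * R) powr p"
    using assms by (intro powr_mono2 sum_nonneg) auto
  then show ?thesis using R by (simp add: powr_mult)
qed

lemma schatten_class_svd:
  assumes "T \<in> schatten_class p"
  obtains e f where "svd T (singular_values T) e f" "summable (\<lambda>j. singular_values T j powr p)"
  using assms singular_value_decomposition unfolding schatten_class_def by blast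

text \<open>The singular values of the combination are its diagonal coefficients at its own singular
  vectors, hence combinations of coefficients of the \<open>A i\<close>;
  \<open>svd_diagonal_powr_sum_le\<close> bounds their p-th powers independently of the number of
  terms.\<close>

lemma schatten_class_combination:
  fixes A :: "'i \<Rightarrow> ('a::complex_hilbert_space \<Rightarrow>\<^sub>L 'a)"
  assumes p: "p > 1" and I: "finite I" and A: "\<And>i. i \<in> I \<Longrightarrow> A i \<in> schatten_class p"
  shows "(\<Sum>i\<in>I. t i *\<^sub>R A i) \<in> schatten_class p"
proof -
  define D where "D = (\<Sum>i\<in>I. t i *\<^sub>R A i)"
  have D: "D \<in> bounded_ops" "compact_op D"
    using combination_compact_bounded_ops[of I A t] A unfolding D_def schatten_class_def by auto
  obtain e f where svd: "svd D (singular_values D) e f"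
    by (rule singular_value_decomposition[OF D])
  define C where "C = real (card I) powr p * (\<Sum>i\<in>I. \<bar>t i\<bar> powr p * (\<Sum>j. singular_values (A i) j powr p))"
  have "summable (\<lambda>j. singular_values D j powr p)"
  proof (rule summableI_nonneg_bounded)
    fix n
    have "(\<Sum>j<n. singular_values D j powr p)
        \<le> (\<Sum>j<n. real (card I) powr p * (\<Sum>i\<in>I. \<bar>t i\<bar> powr p * cmod (cinner (A i (e j)) (f j)) powr p))"
    proof (intro sum_mono)
      fix j
      have "singular_values D j = cmod (cinner (D (e j)) (f j))"
        using svdD(2)[OF svd] by (simp add: svd_diagonal[OF svd])
      also have "cinner (D (e j)) (f j) = (\<Sum>i\<in>I. of_real (t i) * cinner (A i (e j)) (f j))"
        by (simp add: D_def blinfun.sum_left blinfun.scaleR_left cinner_sum_left cinner_simps)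
      also have "cmod \<dots> \<le> (\<Sum>i\<in>I. \<bar>t i\<bar> * cmod (cinner (A i (e j)) (f j)))"
        by (intro sum_norm_le) (simp add: norm_mult)
      finally have "singular_values D j powr p \<le> (\<Sum>i\<in>I. \<bar>t i\<bar> * cmod (cinner (A i (e j)) (f j))) powr p"
        using p svdD(2)[OF svd] by (intro powr_mono2) auto
      also have "\<dots> \<le> real (card I) powr p * (\<Sum>i\<in>I. (\<bar>t i\<bar> * cmod (cinner (A i (e j)) (f j))) powr p)"
        using p by (intro powr_sum_le_card I) auto
      finally show "singular_values D j powr p
          \<le> real (card I) powr p * (\<Sum>i\<in>I. \<bar>t i\<bar> powr p * cmod (cinner (A i (e j)) (f j)) powr p)"
        by (simp add: powr_mult)
    qed
    also have "\<dots> = real (card I) powr p * (\<Sum>i\<in>I. \<bar>t i\<bar> powr p * (\<Sum>j<n. cmod (cinner (A i (e j)) (f j)) powr p))"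
      by (simp add: sum_distrib_left sum.swap[of _ I "{..<n}"])
    also have "\<dots> \<le> C"
      unfolding C_def
    proof (intro mult_left_mono sum_mono)
      fix i assume "i \<in> I"
      from A[OF this] obtain e' f' where "svd (A i) (singular_values (A i)) e' f'"
        "summable (\<lambda>j. singular_values (A i) j powr p)" by (rule schatten_class_svd)
      then show "(\<Sum>j<n. cmod (cinner (A i (e j)) (f j)) powr p) \<le> (\<Sum>j. singular_values (A i) j powr p)"
        using svdD(4,5)[OF svd] by (intro svd_diagonal_powr_sum_le p) (auto intro: ortho_sys_subset)
    qed auto
    finally show "(\<Sum>j<n. singular_values D j powr p) \<le> C" .
  qed simp
  with D show ?thesis unfolding D_def schatten_class_def by blast
qed

lemma schatten_norm_powr:
  assumes "T \<in> schatten_class p"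
  shows "schatten_norm p T powr r = (\<Sum>j. singular_values T j powr p) powr (r / p)"
  unfolding schatten_norm_def by (simp add: powr_powr)

section \<open>Clarkson inequalities for isometric combinations\<close>

text \<open>Isolates what interpolation uses of the coefficients: entries bounded by 1 and
  orthogonal columns of equal length.\<close>

locale schatten_combinations =
  fixes K :: "'k set" and I :: "'i set" and t :: "'k \<Rightarrow> 'i \<Rightarrow> real" and N p q :: real
    and A :: "'i \<Rightarrow> ('a::complex_hilbert_space \<Rightarrow>\<^sub>L 'a)" and D :: "'k \<Rightarrow> ('a \<Rightarrow>\<^sub>L 'a)"
  assumes fin: "finite K" "finite I"
    and t: "\<And>k i. k \<in> K \<Longrightarrow> i \<in> I \<Longrightarrow> \<bar>t k i\<bar> \<le> 1"
    and T: "\<And>i j. i \<in> I \<Longrightarrow> j \<in> I \<Longrightarrow> (\<Sum>k\<in>K. t k i * t k j) = (if i = j then N else 0)"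
    and N: "N > 0"
    and A: "\<And>i. i \<in> I \<Longrightarrow> A i \<in> schatten_class p"
    and D: "\<And>k. k \<in> K \<Longrightarrow> D k = (\<Sum>i\<in>I. t k i *\<^sub>R A i)"
    and p: "1 < p" and pq: "1 / p + 1 / q = 1"
begin

abbreviation "\<sigma> T j \<equiv> singular_values T j"

lemma q: "q > 1" "(p - 1) * q = p" "q / p = q - 1" "p / q = p - 1" "1 / q = 1 - 1 / p"
proof -
  have "q \<noteq> 0" using pq p by auto
  have "1 / p < 1" using p by simp
  then have "1 / q > 0" using pq by linarith
  then have "q > 0" by simp
  have e: "q + p = p * q" using pq p \<open>q > 0\<close> by (simp add: field_simps)
  then show "(p - 1) * q = p" "q / p = q - 1" "p / q = p - 1"
    using p \<open>q > 0\<close> by (simp_all add: field_simps)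
  show "1 / q = 1 - 1 / p" using pq by simp
  have "q / p > 0" using p \<open>q > 0\<close> by simp
  then show "q > 1" using \<open>q / p = q - 1\<close> by simp
qed

lemma D_schatten: "k \<in> K \<Longrightarrow> D k \<in> schatten_class p"
  unfolding D by (intro schatten_class_combination p fin A)

lemma summable_A: "i \<in> I \<Longrightarrow> summable (\<lambda>j. \<sigma> (A i) j powr p)"
  using A unfolding schatten_class_def by blast

lemma summable_D: "k \<in> K \<Longrightarrow> summable (\<lambda>j. \<sigma> (D k) j powr p)"
  using D_schatten unfolding schatten_class_def by blast

lemma cinner_D: "k \<in> K \<Longrightarrow> cinner (D k x) y = (\<Sum>i\<in>I. of_real (t k i) * cinner (A i x) y)"
  by (simp add: D blinfun.sum_left blinfun.scaleR_left cinner_sum_left cinner_simps)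

text \<open>Column orthogonality makes the transposed coefficients invert the map from
  \<open>A\<close> to \<open>D\<close> up to the factor \<open>N\<close>, stated weakly as needed
  for matrix coefficients.\<close>

lemma cinner_A:
  assumes "i \<in> I"
  shows "(\<Sum>k\<in>K. of_real (t k i) * cinner (D k x) y) = of_real N * cinner (A i x) y"
proof -
  have "(\<Sum>k\<in>K. of_real (t k i) * cinner (D k x) y)
      = (\<Sum>k\<in>K. \<Sum>j\<in>I. of_real (t k i * t k j) * cinner (A j x) y)"
    by (intro sum.cong refl) (simp add: cinner_D sum_distrib_left mult.assoc)
  also have "\<dots> = (\<Sum>j\<in>I. of_real (\<Sum>k\<in>K. t k i * t k j) * cinner (A j x) y)"
    by (subst sum.swap) (simp add: sum_distrib_right)
  also have "\<dots> = (\<Sum>j\<in>I. if i = j then of_real N * cinner (A i x) y else 0)"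
    by (intro sum.cong refl) (auto simp: T[OF assms])
  also have "\<dots> = of_real N * cinner (A i x) y" using assms fin by simp
  finally show ?thesis .
qed

lemma svd_A_choice:
  obtains e f where "\<And>i. i \<in> I \<Longrightarrow> svd (A i) (\<sigma> (A i)) (e i) (f i)"
proof -
  have "\<forall>i\<in>I. \<exists>e f. svd (A i) (\<sigma> (A i)) e f" by (metis A schatten_class_svd)
  then show thesis using that by metis
qed

lemma svd_D_choice:
  obtains e f where "\<And>k. k \<in> K \<Longrightarrow> svd (D k) (\<sigma> (D k)) (e k) (f k)"
proof -
  have "\<forall>k\<in>K. \<exists>e f. svd (D k) (\<sigma> (D k)) e f" by (metis D_schatten schatten_class_svd)
  then show thesis using that by metis
qed

text \<open>The truncated singular values of the \<open>D k\<close> are paired with their extremal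
  functional; interpolation bounds the pairing, and the resulting inequality for \<open>R\<close> is
  solved for \<open>R\<close>.\<close>

lemma clarkson_le_two:
  assumes p2: "p \<le> 2"
  shows "(\<Sum>k\<in>K. (\<Sum>j. \<sigma> (D k) j powr p) powr (q / p))
    \<le> N * (\<Sum>i\<in>I. \<Sum>j. \<sigma> (A i) j powr p) powr (q / p)"
proof -
  obtain e f where A_svd: "\<And>i. i \<in> I \<Longrightarrow> svd (A i) (\<sigma> (A i)) (e i) (f i)"
    by (rule svd_A_choice) blast
  obtain e' f' where D_svd: "\<And>k. k \<in> K \<Longrightarrow> svd (D k) (\<sigma> (D k)) (e' k) (f' k)"
    by (rule svd_D_choice) blast
  define P where "P = (\<Sum>i\<in>I. \<Sum>j. \<sigma> (A i) j powr p)"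
  have P: "P \<ge> 0" unfolding P_def by (intro sum_nonneg suminf_nonneg summable_A) auto
  have trunc: "(\<Sum>k\<in>K. (\<Sum>j<n. \<sigma> (D k) j powr p) powr (q / p)) \<le> N * P powr (q / p)" for n
  proof -
    define S where "S = (\<lambda>k. \<Sum>j<n. \<sigma> (D k) j powr p)"
    define R where "R = (\<Sum>k\<in>K. S k powr (q / p))"
    define \<beta> where "\<beta> = (\<lambda>k j. S k powr (q / p - 1) * \<sigma> (D k) j powr (p - 1))"
    have S0: "S k \<ge> 0" for k by (simp add: S_def sum_nonneg)
    have R0: "R \<ge> 0" by (simp add: R_def sum_nonneg)
    have \<beta>q: "(\<Sum>j<n. \<beta> k j powr q) powr (p / q) = S k powr (q / p)" if "k \<in> K" for k
    proof (cases "S k = 0")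
      case False
      then have Sp: "S k > 0" using S0[of k] by simp
      have "(\<Sum>j<n. \<beta> k j powr q) = S k powr ((q / p - 1) * q) * S k"
        unfolding S_def \<beta>_def
        by (simp add: powr_mult powr_powr q(2) sum_distrib_left)
      also have "\<dots> = S k powr ((q / p - 1) * q + 1)"
        using Sp by (simp add: powr_add)
      finally have "(\<Sum>j<n. \<beta> k j powr q) powr (p / q) = S k powr (((q / p - 1) * q + 1) * (p / q))"
        by (simp add: powr_powr)
      \<comment> \<open>After replacing \<open>q / p\<close> by q - 1 and \<open>p / q\<close> by p
        - 1, this is the conjugacy relation (q - 1) (p - 1) = 1.\<close>
      also have "((q / p - 1) * q + 1) * (p / q) = q / p"
      proof -
        have "(q - 1) * (p - 1) = 1"
          using p q(1) by (simp flip: q(3,4))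
        moreover have "((q - 1 - 1) * q + 1) * (p - 1) = (q - 1) * ((q - 1) * (p - 1))"
          by (simp add: algebra_simps)
        ultimately show ?thesis unfolding q(3,4) by simp
      qed
      finally show ?thesis .
    qed (simp add: \<beta>_def)
    have \<beta>S: "(\<Sum>j<n. \<beta> k j * \<sigma> (D k) j) = S k powr (q / p)" if "k \<in> K" for k
    proof (cases "S k = 0")
      case False
      then have Sp: "S k > 0" using S0[of k] by simp
      have "\<sigma> (D k) j powr (p - 1) * \<sigma> (D k) j = \<sigma> (D k) j powr p" for j
        using svdD(2)[OF D_svd[OF that], of j] by (cases "\<sigma> (D k) j = 0") (simp_all add: powr_diff)
      then have "(\<Sum>j<n. \<beta> k j * \<sigma> (D k) j) = S k powr (q / p - 1) * S k"
        unfolding \<beta>_def by (simp add: mult.assoc sum_distrib_left[symmetric] S_def)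
      also have "\<dots> = S k powr (q / p)" using Sp by (simp add: powr_diff)
      finally show ?thesis .
    qed (simp add: \<beta>_def)
    \<comment> \<open>Only the expansions of the \<open>A i\<close> are cut at \<open>m\<close>; as
      \<open>m\<close> grows the form tends to the pairing, which equals \<open>R\<close> by
      \<open>svd_diagonal\<close>.\<close>
    define X where "X = (\<lambda>m. svform K {..<n} I {..<m} t e' f' e f
      (\<lambda>i a. of_real (\<sigma> (A i) a)) (\<lambda>k b. of_real (\<beta> k b)))"
    have "X \<longlonglongrightarrow> (\<Sum>k\<in>K. \<Sum>b<n. \<Sum>i\<in>I. of_real (t k i) * of_real (\<beta> k b) * cinner (A i (e' k b)) (f' k b))"
    proof -
      have "X = (\<lambda>m. \<Sum>k\<in>K. \<Sum>b<n. \<Sum>i\<in>I. of_real (t k i) * of_real (\<beta> k b) *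
          (\<Sum>a<m. of_real (\<sigma> (A i) a) * (cinner (e' k b) (e i a) * cinner (f i a) (f' k b))))"
        unfolding X_def svform_def by (simp add: sum_distrib_left mult_ac)
      then show ?thesis
        using svd_cinner_sums[OF A_svd] unfolding sums_def
        by (auto intro!: tendsto_sum tendsto_mult_left)
    qed
    also have "(\<Sum>k\<in>K. \<Sum>b<n. \<Sum>i\<in>I. of_real (t k i) * of_real (\<beta> k b) * cinner (A i (e' k b)) (f' k b))
        = (\<Sum>k\<in>K. \<Sum>b<n. of_real (\<beta> k b) * cinner (D k (e' k b)) (f' k b))"
      by (intro sum.cong refl) (simp add: cinner_D sum_distrib_left mult_ac)
    also have "\<dots> = (\<Sum>k\<in>K. of_real (\<Sum>b<n. \<beta> k b * \<sigma> (D k) b))"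
      by (intro sum.cong refl) (simp add: svd_diagonal[OF D_svd])
    also have "\<dots> = of_real R"
      by (simp add: \<beta>S R_def)
    finally have lim: "(\<lambda>m. cmod (X m)) \<longlonglongrightarrow> cmod (of_real R)" by (rule tendsto_norm)
    have "cmod (X m) \<le> N powr (1 / q) * P powr (1 / p) * R powr (1 / p)" for m
    proof -
      have "cmod (X m) \<le> N powr (1 / q) * (\<Sum>i\<in>I. \<Sum>a<m. \<sigma> (A i) a powr p) powr (1 / p) *
        (\<Sum>k\<in>K. (\<Sum>b<n. \<beta> k b powr q) powr (p / q)) powr (1 / p)"
        unfolding X_def
      proof (rule svform_interpolation)
        show "ortho_sys {..<m} (e i)" "ortho_sys {..<m} (f i)" if "i \<in> I" for i
          using svdD(4,5)[OF A_svd[OF that]] by (auto intro: ortho_sys_subset)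
        show "ortho_sys {..<n} (e' k)" "ortho_sys {..<n} (f' k)" if "k \<in> K" for k
          using svdD(4,5)[OF D_svd[OF that]] by (auto intro: ortho_sys_subset)
        show "0 \<le> \<sigma> (A i) a" if "i \<in> I" for i a by (rule svdD(2)[OF A_svd[OF that]])
        show "0 \<le> \<beta> k b" for k b by (simp add: \<beta>_def)
      qed (use fin t T N p p2 pq in auto)
      also have "(\<Sum>k\<in>K. (\<Sum>b<n. \<beta> k b powr q) powr (p / q)) = R"
        by (simp add: \<beta>q R_def)
      also have "N powr (1 / q) * (\<Sum>i\<in>I. \<Sum>a<m. \<sigma> (A i) a powr p) powr (1 / p) * R powr (1 / p)
          \<le> N powr (1 / q) * P powr (1 / p) * R powr (1 / p)"
        unfolding P_def using p
        by (intro mult_right_mono mult_left_mono powr_mono2 sum_mono sum_le_suminf summable_A) (auto intro!: sum_nonneg)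
      finally show ?thesis .
    qed
    then have "cmod (of_real R) \<le> N powr (1 / q) * P powr (1 / p) * R powr (1 / p)"
      using LIMSEQ_le_const2[OF lim] by blast
    \<comment> \<open>For \<open>R > 0\<close>, dividing by \<open>R powr (1 / p)\<close> leaves
      \<open>R powr (1 / q)\<close>, and the q-th power gives the factor \<open>N\<close> and the
      exponent \<open>q / p\<close>.\<close>
    then have le: "R \<le> (N powr (1 / q) * P powr (1 / p)) * R powr (1 / p)" using R0 by simp
    have "R \<le> N * P powr (q / p)"
    proof (cases "R = 0")
      case True then show ?thesis using N by simp
    next
      case False
      then have Rp: "R > 0" using R0 by simp
      have "R powr (1 / q) = R / R powr (1 / p)"
        using Rp by (simp add: q(5) powr_diff)
      also have "\<dots> \<le> N powr (1 / q) * P powr (1 / p)"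
        using le Rp by (simp add: divide_le_eq)
      finally have "(R powr (1 / q)) powr q \<le> (N powr (1 / q) * P powr (1 / p)) powr q"
        using q(1) by (intro powr_mono2) auto
      then show ?thesis using Rp q(1) N by (simp add: powr_powr powr_mult)
    qed
    then show ?thesis by (simp add: R_def S_def)
  qed
  have "(\<lambda>n. \<Sum>k\<in>K. (\<Sum>j<n. \<sigma> (D k) j powr p) powr (q / p))
      \<longlonglongrightarrow> (\<Sum>k\<in>K. (\<Sum>j. \<sigma> (D k) j powr p) powr (q / p))"
    using p q(1)
    by (intro tendsto_sum tendsto_powr' summable_LIMSEQ summable_D tendsto_const) (auto intro!: sum_nonneg always_eventually)
  then show ?thesis
    using LIMSEQ_le_const2 trunc unfolding P_def by blast
qed

text \<open>Here q is at most 2, so interpolation runs with r = q and s = p: the dual elements of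
  the \<open>A i\<close> take the place of the operators, and the \<open>D k\<close> that of the
  test operators.\<close>

lemma clarkson_ge_two:
  assumes p2: "p \<ge> 2"
  shows "N * (\<Sum>i\<in>I. \<Sum>j. \<sigma> (A i) j powr p) powr (q / p)
    \<le> (\<Sum>k\<in>K. (\<Sum>j. \<sigma> (D k) j powr p) powr (q / p))"
proof -
  obtain e f where A_svd: "\<And>i. i \<in> I \<Longrightarrow> svd (A i) (\<sigma> (A i)) (e i) (f i)"
    by (rule svd_A_choice) blast
  obtain e' f' where D_svd: "\<And>k. k \<in> K \<Longrightarrow> svd (D k) (\<sigma> (D k)) (e' k) (f' k)"
    by (rule svd_D_choice) blast
  define Z where "Z = (\<Sum>k\<in>K. (\<Sum>j. \<sigma> (D k) j powr p) powr (q / p))"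
  have Z: "Z \<ge> 0" unfolding Z_def by (intro sum_nonneg) auto
  have q2: "q \<le> 2"
  proof -
    have "1 / p \<le> 1 / 2" using p2 by (simp add: field_simps)
    then have "1 / q \<ge> 1 / 2" using q(5) by linarith
    then show ?thesis using q(1) by (simp add: field_simps)
  qed
  have trunc: "N * (\<Sum>i\<in>I. \<Sum>j<m. \<sigma> (A i) j powr p) powr (q / p) \<le> Z" for m
  proof -
    define P where "P = (\<Sum>i\<in>I. \<Sum>j<m. \<sigma> (A i) j powr p)"
    have P0: "P \<ge> 0" by (simp add: P_def sum_nonneg)
    \<comment> \<open>The norming element for the p-norm over all pairs; inner and outer exponents
      coincide, so no row weight appears.\<close>
    define \<alpha> where "\<alpha> = (\<lambda>i j. \<sigma> (A i) j powr (p - 1))"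
    have \<alpha>q: "(\<Sum>i\<in>I. \<Sum>j<m. \<alpha> i j powr q) = P"
      by (simp add: \<alpha>_def powr_powr q(2) P_def)
    have \<alpha>P: "(\<Sum>i\<in>I. \<Sum>j<m. \<alpha> i j * \<sigma> (A i) j) = P"
      unfolding P_def
    proof (intro sum.cong refl)
      fix i j assume "i \<in> I"
      then show "\<alpha> i j * \<sigma> (A i) j = \<sigma> (A i) j powr p"
        using svdD(2)[OF A_svd, of i j] by (cases "\<sigma> (A i) j = 0") (simp_all add: \<alpha>_def powr_diff)
    qed
    \<comment> \<open>With \<open>f'\<close> before \<open>e'\<close> the second family of operators
      in the form is \<open>D k\<close> itself, cut at \<open>n\<close>; with \<open>f\<close>
      before \<open>e\<close> the first one consists of the dual elements, which map the left
      singular vectors of \<open>A i\<close> back to the right ones.\<close>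
    define X where "X = (\<lambda>n. svform K {..<n} I {..<m} t f' e' f e
      (\<lambda>i a. of_real (\<alpha> i a)) (\<lambda>k b. of_real (\<sigma> (D k) b)))"
    have "X \<longlonglongrightarrow> (\<Sum>k\<in>K. \<Sum>i\<in>I. \<Sum>a<m. of_real (t k i) * of_real (\<alpha> i a) * cinner (D k (e i a)) (f i a))"
    proof -
      have "X n = (\<Sum>k\<in>K. \<Sum>i\<in>I. \<Sum>a<m. of_real (t k i) * of_real (\<alpha> i a) *
          (\<Sum>b<n. of_real (\<sigma> (D k) b) * (cinner (e i a) (e' k b) * cinner (f' k b) (f i a))))" for n
        unfolding X_def svform_def sum_distrib_left
        by (simp only: sum.swap[of _ _ "{..<n}"]) (simp add: mult_ac)
      then have "X = (\<lambda>n. \<Sum>k\<in>K. \<Sum>i\<in>I. \<Sum>a<m. of_real (t k i) * of_real (\<alpha> i a) *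
          (\<Sum>b<n. of_real (\<sigma> (D k) b) * (cinner (e i a) (e' k b) * cinner (f' k b) (f i a))))"
        by (rule ext)
      then show ?thesis
        using svd_cinner_sums[OF D_svd] unfolding sums_def
        by (auto intro!: tendsto_sum tendsto_mult_left)
    qed
    also have "(\<Sum>k\<in>K. \<Sum>i\<in>I. \<Sum>a<m. of_real (t k i) * of_real (\<alpha> i a) * cinner (D k (e i a)) (f i a))
        = (\<Sum>i\<in>I. \<Sum>a<m. \<Sum>k\<in>K. of_real (\<alpha> i a) * (of_real (t k i) * cinner (D k (e i a)) (f i a)))"
      by (simp only: sum.swap[of _ _ K]) (simp add: mult_ac)
    \<comment> \<open>\<open>cinner_A\<close> collapses the sum over \<open>k\<close> to N times a
      coefficient of \<open>A i\<close>, which is a singular value.\<close>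
    also have "\<dots> = (\<Sum>i\<in>I. \<Sum>a<m. of_real (\<alpha> i a) * (of_real N * of_real (\<sigma> (A i) a)))"
      by (intro sum.cong refl) (simp add: sum_distrib_left[symmetric] cinner_A svd_diagonal[OF A_svd])
    also have "\<dots> = of_real (N * (\<Sum>i\<in>I. \<Sum>a<m. \<alpha> i a * \<sigma> (A i) a))"
      by (simp add: sum_distrib_left mult_ac)
    also have "\<dots> = of_real (N * P)" by (simp only: \<alpha>P)
    finally have lim: "(\<lambda>n. cmod (X n)) \<longlonglongrightarrow> cmod (of_real (N * P))" by (rule tendsto_norm)
    have "cmod (X n) \<le> N powr (1 / p) * P powr (1 / q) * Z powr (1 / q)" for n
    proof -
      have "cmod (X n) \<le> N powr (1 / p) * (\<Sum>i\<in>I. \<Sum>a<m. \<alpha> i a powr q) powr (1 / q) *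
        (\<Sum>k\<in>K. (\<Sum>b<n. \<sigma> (D k) b powr p) powr (q / p)) powr (1 / q)"
        unfolding X_def
      proof (rule svform_interpolation)
        show "ortho_sys {..<m} (e i)" "ortho_sys {..<m} (f i)" if "i \<in> I" for i
          using svdD(4,5)[OF A_svd[OF that]] by (auto intro: ortho_sys_subset)
        show "ortho_sys {..<n} (e' k)" "ortho_sys {..<n} (f' k)" if "k \<in> K" for k
          using svdD(4,5)[OF D_svd[OF that]] by (auto intro: ortho_sys_subset)
        show "0 \<le> \<sigma> (D k) b" if "k \<in> K" for k b by (rule svdD(2)[OF D_svd[OF that]])
        show "0 \<le> \<alpha> i a" for i a by (simp add: \<alpha>_def)
      qed (use fin t T N q q2 pq in auto)
      also have "(\<Sum>k\<in>K. (\<Sum>b<n. \<sigma> (D k) b powr p) powr (q / p)) powr (1 / q) \<le> Z powr (1 / q)"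
        unfolding Z_def using p q(1)
        by (intro powr_mono2 sum_mono sum_le_suminf summable_D) (auto intro!: sum_nonneg)
      finally show ?thesis unfolding \<alpha>q using N by (simp add: mult_left_mono)
    qed
    then have "cmod (of_real (N * P)) \<le> N powr (1 / p) * P powr (1 / q) * Z powr (1 / q)"
      using LIMSEQ_le_const2[OF lim] by blast
    then have le: "N * P \<le> (N powr (1 / p) * P powr (1 / q)) * Z powr (1 / q)"
      using N P0 by (simp add: norm_mult)
    show ?thesis
    proof (cases "P = 0")
      case True then show ?thesis using Z by (simp add: P_def)
    next
      case False
      then have Pp: "P > 0" using P0 by simp
      have "N powr (1 / q) * P powr (1 / p) = N * P / (N powr (1 / p) * P powr (1 / q))"
        using Pp N by (simp add: q(5) powr_diff)
      also have "\<dots> \<le> Z powr (1 / q)"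
        using le Pp N by (simp add: divide_le_eq mult_ac)
      finally have "(N powr (1 / q) * P powr (1 / p)) powr q \<le> (Z powr (1 / q)) powr q"
        using q(1) by (intro powr_mono2) auto
      then show ?thesis using Z q(1) N by (simp add: powr_powr powr_mult P_def)
    qed
  qed
  have "(\<lambda>m. N * (\<Sum>i\<in>I. \<Sum>j<m. \<sigma> (A i) j powr p) powr (q / p))
      \<longlonglongrightarrow> N * (\<Sum>i\<in>I. \<Sum>j. \<sigma> (A i) j powr p) powr (q / p)"
    using p q(1)
    by (intro tendsto_mult_left tendsto_sum tendsto_powr' summable_LIMSEQ summable_A tendsto_const)
      (auto intro!: sum_nonneg always_eventually)
  then show ?thesis
    using LIMSEQ_le_const2 trunc unfolding Z_def by blast
qed

end

text \<open>
  The coefficients of the combinations in the theorem: \<open>(0, 0)\<close> stands for the sum of all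
  operators, and \<open>(a, b)\<close> for the difference of the \<open>a\<close>-th and the \<open>b\<close>-th one.
\<close>

definition sum_diff_coeff :: "nat \<times> nat \<Rightarrow> nat \<Rightarrow> real" where
  "sum_diff_coeff k i = (if k = (0, 0) then 1 else if i = fst k then 1 else if i = snd k then - 1 else 0)"

abbreviation (input) index_pairs :: "nat \<Rightarrow> (nat \<times> nat) set" where
  "index_pairs n \<equiv> {(i, j). 1 \<le> i \<and> i < j \<and> j \<le> n}"

lemma finite_index_pairs: "finite (index_pairs n)"
  by (rule finite_subset[of _ "{1..n} \<times> {1..n}"]) auto

lemma card_index_pairs_containing:
  assumes "i \<in> {1..n}"
  shows "card {(a, b) \<in> index_pairs n. a = i \<or> b = i} = n - 1"
proof -
  have "{(a, b) \<in> index_pairs n. a = i \<or> b = i} = {i} \<times> {i<..n} \<union> {1..<i} \<times> {i}"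
    using assms by auto
  also have "card \<dots> = card ({i} \<times> {i<..n}) + card ({1..<i} \<times> {i})"
    by (intro card_Un_disjoint) auto
  also have "\<dots> = n - 1" using assms by (simp add: card_cartesian_product)
  finally show ?thesis .
qed

text \<open>On the diagonal the total sum contributes 1 and each of the n - 1 differences involving
  \<open>i\<close> contributes 1. Off the diagonal the 1 from the total sum cancels the -1 from the
  single difference involving both indices.\<close>

lemma sum_diff_coeff_isometry:
  assumes i: "i \<in> {1..n}" and j: "j \<in> {1..n}"
  shows "(\<Sum>k\<in>insert (0, 0) (index_pairs n). sum_diff_coeff k i * sum_diff_coeff k j)
    = (if i = j then real n else 0)"
proof -
  have "(\<Sum>k\<in>insert (0, 0) (index_pairs n). sum_diff_coeff k i * sum_diff_coeff k j)
      = 1 + (\<Sum>k\<in>index_pairs n. sum_diff_coeff k i * sum_diff_coeff k j)"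
    by (subst sum.insert[OF finite_index_pairs]) (simp_all add: sum_diff_coeff_def)
  also have "\<dots> = (if i = j then real n else 0)"
  proof (cases "i = j")
    case True
    have "(\<Sum>k\<in>index_pairs n. sum_diff_coeff k i * sum_diff_coeff k i)
        = (\<Sum>k\<in>index_pairs n. if k \<in> {(a, b) \<in> index_pairs n. a = i \<or> b = i} then 1 else 0)"
      by (intro sum.cong refl) (auto simp: sum_diff_coeff_def)
    also have "\<dots> = real (card {(a, b) \<in> index_pairs n. a = i \<or> b = i})"
      by (subst sum.inter_restrict[OF finite_index_pairs, symmetric])
        (simp add: Int_absorb1 subset_iff)
    finally show ?thesis
      using True i unfolding card_index_pairs_containing[OF i] by (simp add: of_nat_diff)
  next
    case False
    have "(\<Sum>k\<in>index_pairs n. sum_diff_coeff k i * sum_diff_coeff k j)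
        = (\<Sum>k\<in>index_pairs n. if k = (min i j, max i j) then - 1 else 0)"
      by (intro sum.cong refl) (use False in \<open>auto simp: sum_diff_coeff_def min_def max_def\<close>)
    also have "\<dots> = - 1"
      using False i j finite_index_pairs by (subst sum.delta) (auto simp: min_def max_def)
    finally show ?thesis using False by simp
  qed
  finally show ?thesis .
qed

theorem mainTheorem1:
  fixes A :: "nat \<Rightarrow> ('a::complex_hilbert_space \<Rightarrow>\<^sub>L 'a)"
    and n :: nat and p q :: real
  assumes "separable_space (euclidean :: 'a topology)"
    and "n \<ge> 1"
    and "p > 0" and "q > 0" and "1 / p + 1 / q = 1"
    and "\<And>i. i \<in> {1..n} \<Longrightarrow> A i \<in> schatten_class p"
  shows "(1 < p \<and> p \<le> 2 \<longrightarrow>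
      schatten_norm p (\<Sum>i=1..n. A i) powr q
        + (\<Sum>(i, j)\<in>{(i, j). 1 \<le> i \<and> i < j \<and> j \<le> n}. schatten_norm p (A i - A j) powr q)
      \<le> real n * (\<Sum>i=1..n. schatten_norm p (A i) powr p) powr (q / p))
    \<and> (2 \<le> p \<longrightarrow>
      real n * (\<Sum>i=1..n. schatten_norm p (A i) powr p) powr (q / p)
      \<le> schatten_norm p (\<Sum>i=1..n. A i) powr q
        + (\<Sum>(i, j)\<in>{(i, j). 1 \<le> i \<and> i < j \<and> j \<le> n}. schatten_norm p (A i - A j) powr q))"
proof -
  have p1: "1 < p"
  proof -
    have "1 / p < 1" using assms(4,5) by (smt (verit) zero_less_divide_1_iff)
    then show ?thesis using assms(3) by (simp add: field_simps)
  qed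
  \<comment> \<open>The pair \<open>(0, 0)\<close> is no index pair, since indices start at 1, so it
    can label the total sum.\<close>
  define D where "D = (\<lambda>k. if k = (0, 0) then \<Sum>i=1..n. A i else A (fst k) - A (snd k))"
  interpret schatten_combinations "insert (0, 0) (index_pairs n)" "{1..n}" sum_diff_coeff "real n" p q A D
  proof
    show "D k = (\<Sum>i=1..n. sum_diff_coeff k i *\<^sub>R A i)" if "k \<in> insert (0, 0) (index_pairs n)" for k
    proof (cases "k = (0, 0)")
      case True then show ?thesis by (simp add: D_def sum_diff_coeff_def)
    next
      case False
      then obtain a b where k: "k = (a, b)" "1 \<le> a" "a < b" "b \<le> n" using \<open>k \<in> _\<close> by auto
      have "(\<Sum>i=1..n. sum_diff_coeff k i *\<^sub>R A i)
          = (\<Sum>i=1..n. (if i = a then A a else 0) - (if i = b then A b else 0))"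
        using k by (intro sum.cong refl) (auto simp: sum_diff_coeff_def)
      also have "\<dots> = A a - A b" using k by (simp add: sum_subtractf)
      finally show ?thesis using k by (simp add: D_def)
    qed
    show "\<bar>sum_diff_coeff k i\<bar> \<le> 1" for k i by (simp add: sum_diff_coeff_def)
  qed (use finite_index_pairs sum_diff_coeff_isometry assms p1 in auto)
  have norm_A: "(\<Sum>i=1..n. schatten_norm p (A i) powr p) = (\<Sum>i=1..n. \<Sum>j. singular_values (A i) j powr p)"
    using p1 by (intro sum.cong refl)
      (simp add: schatten_norm_powr A suminf_nonneg summable_A)
  have "(\<Sum>k\<in>insert (0, 0) (index_pairs n). (\<Sum>j. singular_values (D k) j powr p) powr (q / p))
      = (\<Sum>k\<in>insert (0, 0) (index_pairs n). schatten_norm p (D k) powr q)"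
    by (intro sum.cong refl) (simp add: schatten_norm_powr D_schatten)
  also have "\<dots> = schatten_norm p (\<Sum>i=1..n. A i) powr q
      + (\<Sum>k\<in>index_pairs n. schatten_norm p (D k) powr q)"
    by (subst sum.insert[OF finite_index_pairs]) (simp_all add: D_def)
  also have "(\<Sum>k\<in>index_pairs n. schatten_norm p (D k) powr q)
      = (\<Sum>(i, j)\<in>index_pairs n. schatten_norm p (A i - A j) powr q)"
    by (intro sum.cong refl) (auto simp: D_def)
  finally show ?thesis
    using clarkson_le_two clarkson_ge_two unfolding norm_A by simp
qed

end
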